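(* Let $\mathcal{W}\subset\mathbb{R}^d$ be a closed convex set and let $\{\ell(\cdot,x)\}_{x\in\mathcal{X}}$ be a family of convex, differentiable, $L$-Lipschitz functions on $\mathcal{W}$ (so $\|\nabla_w\ell(w,x)\|\le L$ for all $w\in\mathcal{W}$, $x\in\mathcal{X}$). Let $\eta>0$, $\sigma>0$ and $n\ge1$. Then the randomly-stopped projected noisy SGD (PNSGD) algorithm is $(\varepsilon,\delta)$-DP for every $\varepsilon\ge0$ with $$\delta=\frac1n\,\theta_{e^\varepsilon}\Big(\frac{2L}{\sigma}\Big)\left[1-\theta_{e^\varepsilon}\Big(\frac{\mathrm{dia}(\mathcal{W})+2\eta L}{\eta\sigma}\Big)\right]^{-1}.$$
   Context: Randomly-stopped PNSGD: given a dataset $\{x_1,\dots,x_n\}\in\mathcal{X}^n$, draw $W_1\sim\mu_1$ for some fixed $\mu_1\in\mathcal{P}(\mathcal{W})$ (a probability measure on $\mathcal{W}$), draw $T$ uniformly from $\{1,\dots,n\}$, for $t=1,\dots,T$ set $W_{t+1}=\Pi_{\mathcal{W}}\big(W_t-\eta[\nabla_w\ell(W_t,x_t)+\sigma Z_t]\big)$ with $Z_t\sim\mathcal{N}(0,\mathbf{I}_d)$ i.i.d. ($W_1,T,\{Z_t\}$ independent), and output $W_{T+1}$ only. $\Pi_{\mathcal{W}}$ is Euclidean projection onto $\mathcal{W}$, and $\mathrm{dia}(\mathcal{W})=\sup_{w_1,w_2\in\mathcal{W}}\|w_1-w_2\|$. The algorithm is $(\varepsilon,\delta)$-DP if for any two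 datasets in $\mathcal{X}^n$ differing in exactly one entry, the output distributions $\mu,\mu'$ satisfy $\mathsf{E}_{e^\varepsilon}(\mu\|\mu')\le\delta$, where for $\gamma\ge1$, $\mathsf{E}_\gamma(\mu\|\nu)=\sup_A[\mu(A)-\gamma\nu(A)]$ over measurable $A$. For $\gamma\ge1$ and $r>0$, $\theta_\gamma(r)=\mathsf{Q}\left(\frac{\log\gamma}{r}-\frac r2\right)-\gamma\mathsf{Q}\left(\frac{\log\gamma}{r}+\frac r2\right)$ with $\mathsf{Q}(a)=\frac1{\sqrt{2\pi}}\int_a^\infty e^{-u^2/2}du$; $\theta_\gamma(0)=0$; when $\mathrm{dia}(\mathcal{W})=\infty$ the right-hand side is read as $+\infty$ (trivial bound). *)

theory Defs
  imports "HOL-Probability.Probability"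
begin

definition gaussian_Q :: "real \<Rightarrow> real" where
  "gaussian_Q a = 1 / sqrt (2 * pi) * (LBINT u:{a..}. exp (- u\<^sup>2 / 2))"

definition theta :: "real \<Rightarrow> real \<Rightarrow> real" where
  "theta \<gamma> r =
     (if r = 0 then 0
      else gaussian_Q (ln \<gamma> / r - r / 2) - \<gamma> * gaussian_Q (ln \<gamma> / r + r / 2))"

text \<open>The divergence is only used for probability measures on the same measurable space;
  the set of values is then bounded above by 1, so the supremum in the reals is the true one.\<close>

definition E_divergence :: "real \<Rightarrow> 'a measure \<Rightarrow> 'a measure \<Rightarrow> real" where
  "E_divergence \<gamma> \<mu> \<nu> = (SUP A\<in>sets \<mu>. measure \<mu> A - \<gamma> * measure \<nu> A)"

text \<open>Datasets in \<open>X\<^sup>n\<close> are extensional functions on \<open>{1..n}\<close>, and a mechanism sends a dataset to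
  its output distribution. The parameter \<open>\<delta>\<close> may be infinite.\<close>

definition differentially_private ::
    "'x set \<Rightarrow> nat \<Rightarrow> ((nat \<Rightarrow> 'x) \<Rightarrow> 'a measure) \<Rightarrow> real \<Rightarrow> ereal \<Rightarrow> bool" where
  "differentially_private X n mech \<epsilon> \<delta> \<longleftrightarrow>
     (\<forall>x \<in> {1..n} \<rightarrow>\<^sub>E X. \<forall>x' \<in> {1..n} \<rightarrow>\<^sub>E X.
        (\<exists>!i. i \<in> {1..n} \<and> x i \<noteq> x' i) \<longrightarrow>
        ereal (E_divergence (exp \<epsilon>) (mech x) (mech x')) \<le> \<delta>)"

definition std_gaussian :: "'a::euclidean_space measure" where
  "std_gaussian = density lborel (\<lambda>z. ennreal (\<Prod>b\<in>Basis. std_normal_density (z \<bullet> b)))"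

text \<open>The value at \<open>t\<close> is the iterate \<open>W\<^sub>t\<^sub>+\<^sub>1\<close>, obtained from \<open>W\<^sub>1 = w\<close> after processing the data
  points \<open>x\<^sub>1, \<dots>, x\<^sub>t\<close> with noise \<open>z\<^sub>1, \<dots>, z\<^sub>t\<close>; \<open>g u y\<close> is the gradient of the loss in \<open>u\<close> at the
  data point \<open>y\<close>.\<close>

primrec pnsgd_iterate ::
    "'a::euclidean_space set \<Rightarrow> real \<Rightarrow> real \<Rightarrow> ('a \<Rightarrow> 'x \<Rightarrow> 'a) \<Rightarrow> (nat \<Rightarrow> 'x) \<Rightarrow>
     'a \<Rightarrow> (nat \<Rightarrow> 'a) \<Rightarrow> nat \<Rightarrow> 'a" where
  "pnsgd_iterate W \<eta> \<sigma> g x w z 0 = w"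
| "pnsgd_iterate W \<eta> \<sigma> g x w z (Suc t) =
     (let u = pnsgd_iterate W \<eta> \<sigma> g x w z t
      in closest_point W (u - \<eta> *\<^sub>R (g u (x (Suc t)) + \<sigma> *\<^sub>R z (Suc t))))"

text \<open>Law of \<open>W\<^sub>T\<^sub>+\<^sub>1\<close>, where \<open>(W\<^sub>1, T, (Z\<^sub>t)\<^sub>t)\<close> is the identity on the product space below. The
  stopping time has to live on \<open>{1..n}\<close> rather than on all of \<open>nat\<close>: for other values of \<open>T\<close> the
  iterate would use \<open>g\<close> outside the data universe, where it need not be measurable.\<close>

definition randomly_stopped_pnsgd ::
    "'a::euclidean_space set \<Rightarrow> 'a measure \<Rightarrow> real \<Rightarrow> real \<Rightarrow> ('a \<Rightarrow> 'x \<Rightarrow> 'a) \<Rightarrow> nat \<Rightarrow>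
     (nat \<Rightarrow> 'x) \<Rightarrow> 'a measure" where
  "randomly_stopped_pnsgd W \<mu>\<^sub>1 \<eta> \<sigma> g n x =
     distr (\<mu>\<^sub>1 \<Otimes>\<^sub>M (uniform_count_measure {1..n} \<Otimes>\<^sub>M (\<Pi>\<^sub>M t\<in>{1..n}. std_gaussian)))
       (restrict_space borel W)
       (\<lambda>(w, T, z). pnsgd_iterate W \<eta> \<sigma> g x w z T)"

end

theory Submission
  imports Defs
begin

text \<open>
  A bound \<open>E\<^sub>\<gamma>(\<mu> | \<nu>) \<le> a\<close> is the same as \<open>\<integral>k d\<mu> - \<gamma> \<integral>k d\<nu> \<le> a\<close> for all measurable
  \<open>k\<close> with values in \<open>[0,1]\<close>, and in this form it passes to averages and to kernels.
  At the differing entry, both runs start from the same law and add equal Gaussian noise to means at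
  distance at most \<open>2 \<eta> L\<close>, which costs \<open>\<theta>(2L/\<sigma>)\<close>. Every later noisy step contracts \<open>E\<^sub>\<gamma>\<close> by the
  factor \<open>c = \<theta>((dia W + 2 \<eta> L) / (\<eta> \<sigma>)) < 1\<close>, because averaging a test function over the noise
  leaves a function \<open>h\<close> with \<open>h y - \<gamma> h y' \<le> c\<close> for all \<open>y, y'\<close>. Hence stopping at \<open>T \<ge> i\<close> costs at most
  \<open>\<theta>(2L/\<sigma>) c\<^sup>T\<^sup>-\<^sup>i\<close>, stopping earlier costs nothing, and averaging over \<open>T\<close> gives a geometric series.

  If \<open>W\<close> has empty interior, a derivative within \<open>W\<close> leaves the component of the gradient normal to
  the affine hull arbitrary, possibly unbounded and not measurable. Projection onto \<open>W\<close> ignores that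
  component, and the tangential one is bounded by \<open>L\<close> and a pointwise limit of continuous functions.
\<close>

subsection \<open>The standard Gaussian measure\<close>

lemma std_gaussian_prob: "prob_space (std_gaussian :: 'a::euclidean_space measure)"
proof
  have "emeasure (std_gaussian::'a measure) (space std_gaussian) = (\<integral>\<^sup>+z. (\<Prod>b\<in>Basis. ennreal (std_normal_density ((z::'a) \<bullet> b))) \<partial>lborel)"
    by (simp add: std_gaussian_def emeasure_density prod_ennreal)
  also have "\<dots> = (\<Prod>b\<in>(Basis::'a set). \<integral>\<^sup>+x. ennreal (std_normal_density x) \<partial>lborel)"
    by (intro nn_integral_lborel_prod) auto
  also have "(\<integral>\<^sup>+x. ennreal (std_normal_density x) \<partial>lborel) = 1"
    using prob_space.emeasure_space_1[OF prob_space_normal_density[of 1 0]]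
    by (simp add: emeasure_density)
  finally show "emeasure (std_gaussian::'a measure) (space std_gaussian) = 1" by simp
qed

lemma sets_std_gaussian [measurable_cong, simp]: "sets std_gaussian = sets borel"
  by (simp add: std_gaussian_def)

lemma space_std_gaussian [simp]: "space std_gaussian = UNIV"
  by (simp add: std_gaussian_def)

interpretation std_gaussian: prob_space "std_gaussian :: 'a::euclidean_space measure"
  by (rule std_gaussian_prob)

lemma emeasure_std_gaussian_rectangle:
  fixes A :: "'a::euclidean_space \<Rightarrow> real set"
  assumes [measurable]: "\<And>b. b \<in> Basis \<Longrightarrow> A b \<in> sets borel"
  shows "emeasure std_gaussian {z::'a. \<forall>b\<in>Basis. z \<bullet> b \<in> A b} =
     (\<Prod>b\<in>Basis. emeasure (density lborel std_normal_density) (A b))"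
proof -
  have "emeasure std_gaussian {z::'a. \<forall>b\<in>Basis. z \<bullet> b \<in> A b} =
     (\<integral>\<^sup>+z. ennreal (\<Prod>b\<in>Basis. std_normal_density ((z::'a) \<bullet> b)) * indicator {z::'a. \<forall>b\<in>Basis. z \<bullet> b \<in> A b} z \<partial>lborel)"
    unfolding std_gaussian_def by (subst emeasure_density) simp_all
  also have "\<dots> = (\<integral>\<^sup>+z. (\<Prod>b\<in>Basis. ennreal (std_normal_density ((z::'a) \<bullet> b)) * indicator (A b) (z \<bullet> b)) \<partial>lborel)"
    by (intro nn_integral_cong)
      (auto simp: prod.distrib prod_ennreal indicator_def prod_zero_iff split: if_splits)
  also have "\<dots> = (\<Prod>b\<in>Basis. \<integral>\<^sup>+x. ennreal (std_normal_density x) * indicator (A b) x \<partial>lborel)"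
    by (rule nn_integral_lborel_prod) simp_all
  also have "\<dots> = (\<Prod>b\<in>Basis. emeasure (density lborel std_normal_density) (A b))"
    by (intro prod.cong refl) (simp add: emeasure_density)
  finally show ?thesis .
qed

lemma emeasure_std_gaussian_coordinate:
  fixes b :: "'a::euclidean_space"
  assumes "b \<in> Basis" "A \<in> sets borel"
  shows "emeasure std_gaussian {z. z \<bullet> b \<in> A} = emeasure (density lborel std_normal_density) A"
proof -
  have UN: "emeasure (density lborel std_normal_density) UNIV = 1"
    using prob_space.emeasure_space_1[OF prob_space_normal_density[of 1 0]] by simp
  have "{z. z \<bullet> b \<in> A} = {z. \<forall>c\<in>Basis. z \<bullet> c \<in> (if c = b then A else UNIV)}"
    using assms by auto
  then have "emeasure std_gaussian {z. z \<bullet> b \<in> A} =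
     (\<Prod>c\<in>Basis. emeasure (density lborel std_normal_density) (if c = b then A else UNIV))"
    using assms by (simp add: emeasure_std_gaussian_rectangle)
  also have "\<dots> = (\<Prod>c\<in>Basis. if c = b then emeasure (density lborel std_normal_density) A else 1)"
    by (intro prod.cong) (auto simp: UN)
  also have "\<dots> = emeasure (density lborel std_normal_density) A"
    using assms by (simp add: prod.delta)
  finally show ?thesis .
qed

text \<open>Probabilities of rectangles factor, which for finitely many variables is independence.
  It serves to write \<open>z \<bullet> v\<close> as a sum of independent normal variables.\<close>

lemma std_gaussian_indep_coordinates:
  "std_gaussian.indep_vars (\<lambda>_. borel) (\<lambda>b z. z \<bullet> b) (Basis :: 'a::euclidean_space set)"
proof (subst std_gaussian.indep_vars_finite[where E="\<lambda>_. sets borel"])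
  show "\<forall>A\<in>Basis \<rightarrow> sets borel. std_gaussian.prob (\<Inter>j\<in>Basis. (\<lambda>z::'a. z \<bullet> j) -` A j \<inter> space std_gaussian) =
       (\<Prod>j\<in>Basis. std_gaussian.prob ((\<lambda>z. z \<bullet> j) -` A j \<inter> space std_gaussian))"
  proof
    fix A assume A: "A \<in> (Basis::'a set) \<rightarrow> sets (borel::real measure)"
    have "(\<Inter>j\<in>Basis. (\<lambda>z::'a. z \<bullet> j) -` A j \<inter> space std_gaussian) = {z. \<forall>b\<in>Basis. z \<bullet> b \<in> A b}"
      by auto
    then have "emeasure std_gaussian (\<Inter>j\<in>Basis. (\<lambda>z::'a. z \<bullet> j) -` A j \<inter> space std_gaussian)
      = (\<Prod>j\<in>Basis. emeasure std_gaussian ((\<lambda>z. z \<bullet> j) -` A j \<inter> space std_gaussian))"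
      using A by (auto simp: emeasure_std_gaussian_rectangle emeasure_std_gaussian_coordinate vimage_def Pi_iff intro!: prod.cong)
    then show "std_gaussian.prob (\<Inter>j\<in>Basis. (\<lambda>z::'a. z \<bullet> j) -` A j \<inter> space std_gaussian) =
       (\<Prod>j\<in>Basis. std_gaussian.prob ((\<lambda>z. z \<bullet> j) -` A j \<inter> space std_gaussian))"
      by (simp add: std_gaussian.emeasure_eq_measure prod_ennreal prod_nonneg)
  qed
qed (auto simp: Int_stable_def sets.sigma_sets_eq[of borel, simplified])

lemma std_gaussian_coordinate_distributed:
  fixes b :: "'a::euclidean_space"
  assumes "b \<in> Basis"
  shows "distributed std_gaussian lborel (\<lambda>z. z \<bullet> b) std_normal_density"
  unfolding distributed_def
  using assms
  by (auto intro!: measure_eqI simp: emeasure_distr vimage_def emeasure_std_gaussian_coordinate)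

lemma std_gaussian_inner_distributed:
  fixes v :: "'a::euclidean_space"
  assumes "v \<noteq> 0"
  shows "distributed std_gaussian lborel (\<lambda>z. z \<bullet> v) (normal_density 0 (norm v))"
proof -
  \<comment> \<open>Coordinates with \<open>v \<bullet> b = 0\<close> are left out, since their
    summand would be a normal variable of standard deviation 0. As \<open>v \<noteq> 0\<close>, some
    coordinate remains.\<close>
  define I where "I = {b\<in>Basis. v \<bullet> b \<noteq> 0}"
  have I: "finite I" "I \<noteq> {}" "I \<subseteq> Basis"
    using assms using euclidean_all_zero_iff[of v] by (auto simp: I_def)
  have sum_I: "(\<Sum>b\<in>I. f (v \<bullet> b) b) = (\<Sum>b\<in>Basis. f (v \<bullet> b) b)" if "\<And>b. f 0 b = 0" for f :: "real \<Rightarrow> 'a \<Rightarrow> real"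
    by (rule sum.mono_neutral_left) (auto simp: I_def that)
  have "distributed std_gaussian lborel (\<lambda>z::'a. \<Sum>b\<in>I. (v \<bullet> b) * (z \<bullet> b))
     (normal_density (\<Sum>b\<in>I. 0) (sqrt (\<Sum>b\<in>I. \<bar>v \<bullet> b\<bar>\<^sup>2)))"
  proof (rule std_gaussian.sum_indep_normal)
    show "std_gaussian.indep_vars (\<lambda>_. borel) (\<lambda>b z. (v \<bullet> b) * (z \<bullet> b)) I"
      using std_gaussian.indep_vars_compose2[OF std_gaussian.indep_vars_subset[OF std_gaussian_indep_coordinates I(3)],
         of "\<lambda>b x. (v \<bullet> b) * x" "\<lambda>_. borel"] by simp
    fix b assume b: "b \<in> I"
    show "distributed std_gaussian lborel (\<lambda>z. (v \<bullet> b) * (z \<bullet> b)) (normal_density 0 \<bar>v \<bullet> b\<bar>)"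
      using std_gaussian.normal_density_affine[OF std_gaussian_coordinate_distributed[of b], of "v \<bullet> b" 0] b
      by (simp add: I_def)
  qed (use I in \<open>auto simp: I_def\<close>)
  moreover have "(\<Sum>b\<in>I. (v \<bullet> b) * (z \<bullet> b)) = z \<bullet> v" for z
    by (subst sum_I) (auto simp: euclidean_inner[of z v] mult.commute)
  moreover have "sqrt (\<Sum>b\<in>I. \<bar>v \<bullet> b\<bar>\<^sup>2) = norm v"
    by (subst sum_I) (auto simp: norm_eq_sqrt_inner euclidean_inner[of v v] power2_eq_square)
  ultimately show ?thesis by simp
qed

subsection \<open>Gaussian tail and the function theta\<close>

lemma gaussian_Q_eq_measure: "gaussian_Q a = measure (density lborel std_normal_density) {a..}"
proof -
  have "measure (density lborel std_normal_density) {a..}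
      = (\<integral>x. indicator {a..} x \<partial>density lborel (\<lambda>x. ennreal (std_normal_density x)))"
    by simp
  also have "\<dots> = (\<integral>x. std_normal_density x * indicator {a..} x \<partial>lborel)"
    by (subst integral_density) auto
  also have "\<dots> = (\<integral>x. 1 / sqrt (2 * pi) * (indicator {a..} x *\<^sub>R exp (- x\<^sup>2 / 2)) \<partial>lborel)"
    by (intro Bochner_Integration.integral_cong) (auto simp: std_normal_density_def)
  also have "\<dots> = gaussian_Q a"
    unfolding gaussian_Q_def set_lebesgue_integral_def by (rule integral_mult_right_zero)
  finally show ?thesis ..
qed

lemma gaussian_Q_antimono: "a \<le> b \<Longrightarrow> gaussian_Q b \<le> gaussian_Q a"
proof -
  interpret prob_space "density lborel std_normal_density"
    by (rule prob_space_normal_density) simp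
  show "a \<le> b \<Longrightarrow> gaussian_Q b \<le> gaussian_Q a"
    unfolding gaussian_Q_eq_measure by (rule finite_measure_mono) auto
qed

lemma gaussian_Q_le_1: "gaussian_Q a \<le> 1"
proof -
  interpret prob_space "density lborel std_normal_density"
    by (rule prob_space_normal_density) simp
  show ?thesis
    unfolding gaussian_Q_eq_measure by (rule prob_le_1)
qed

text \<open>The normal density vanishes nowhere, so a half-line of probability 0 would be
  Lebesgue-null, although it contains an interval of length 1.\<close>

lemma gaussian_Q_pos: "0 < gaussian_Q a"
proof -
  interpret prob_space "density lborel std_normal_density"
    by (rule prob_space_normal_density) simp
  have "emeasure (density lborel std_normal_density) {a..} \<noteq> 0"
  proof
    assume "emeasure (density lborel std_normal_density) {a..} = 0"
    then have "{a..} \<in> null_sets (density lborel (\<lambda>x. ennreal (std_normal_density x)))"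
      by auto
    then have "AE x in lborel. x \<in> {a..} \<longrightarrow> ennreal (std_normal_density x) = 0"
      by (subst (asm) null_sets_density_iff) auto
    then have "AE x in lborel. x \<notin> {a..}"
    proof eventually_elim
      case (elim x)
      then show ?case using normal_density_pos[of 1 0 x] by auto
    qed
    then have "{a..} \<in> null_sets lborel"
      by (subst (asm) AE_iff_null_sets[symmetric]) auto
    then have "emeasure lborel {a..} = 0"
      by auto
    moreover have "emeasure lborel {a..a+1} \<le> emeasure lborel {a..}"
      by (rule emeasure_mono) auto
    ultimately show False by simp
  qed
  then show ?thesis
    by (simp add: gaussian_Q_eq_measure emeasure_eq_measure order.strict_iff_order)
qed

lemma measure_std_gaussian_halfspace:
  fixes v :: "'a::euclidean_space"
  assumes "v \<noteq> 0"
  shows "measure std_gaussian {z. t \<le> z \<bullet> v} = gaussian_Q (t / norm v)"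
proof -
  have "distributed std_gaussian lborel (\<lambda>z. z \<bullet> v / norm v) std_normal_density"
    using std_gaussian_inner_distributed[OF assms] assms
    by (subst (asm) std_gaussian.normal_standard_normal_convert) auto
  then have "measure std_gaussian {z. t / norm v \<le> z \<bullet> v / norm v} = gaussian_Q (t / norm v)"
    unfolding gaussian_Q_eq_measure distributed_def
    by (auto simp: measure_distr vimage_def dest!: arg_cong[where f="\<lambda>M. measure M {t / norm v..}"])
  then show ?thesis
    using assms by (simp add: divide_le_cancel)
qed

section \<open>Test functions under a shift of the Gaussian\<close>

definition gaussian_pdf :: "'a::euclidean_space \<Rightarrow> real" where
  "gaussian_pdf z = (\<Prod>b\<in>Basis. std_normal_density (z \<bullet> b))"

lemma borel_measurable_gaussian_pdf [measurable]: "gaussian_pdf \<in> borel_measurable borel"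
  unfolding gaussian_pdf_def by measurable

lemma gaussian_pdf_nonneg: "0 \<le> gaussian_pdf z"
  by (simp add: gaussian_pdf_def prod_nonneg)

lemma std_gaussian_eq_density: "std_gaussian = density lborel (\<lambda>z. ennreal (gaussian_pdf z))"
  by (simp add: std_gaussian_def gaussian_pdf_def)

text \<open>The exponential is the likelihood ratio of the Gaussian shifted by \<open>v\<close> to
  the unshifted one. It depends on \<open>z\<close> only through \<open>z \<bullet> v\<close>, so
  for \<open>v \<noteq> 0\<close> its sublevel sets are half-spaces.\<close>

lemma gaussian_pdf_diff:
  "gaussian_pdf (z - v) = gaussian_pdf z * exp (z \<bullet> v - (norm v)\<^sup>2 / 2)"
proof -
  have "std_normal_density ((z - v) \<bullet> b)
      = std_normal_density (z \<bullet> b) * exp ((z \<bullet> b) * (v \<bullet> b) - (v \<bullet> b) * (v \<bullet> b) / 2)" for b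
    unfolding std_normal_density_def
    by (simp add: exp_add[symmetric] inner_diff_left power2_eq_square field_simps)
  then have "gaussian_pdf (z - v)
      = gaussian_pdf z * exp (\<Sum>b\<in>Basis. (z \<bullet> b) * (v \<bullet> b) - (v \<bullet> b) * (v \<bullet> b) / 2)"
    by (simp add: gaussian_pdf_def prod.distrib exp_sum)
  also have "(\<Sum>b\<in>Basis. (z \<bullet> b) * (v \<bullet> b) - (v \<bullet> b) * (v \<bullet> b) / 2) = z \<bullet> v - (norm v)\<^sup>2 / 2"
    by (simp add: power2_norm_eq_inner euclidean_inner[of z v] euclidean_inner[of v v]
        sum_subtractf sum_divide_distrib)
  finally show ?thesis .
qed

text \<open>Translation invariance of Lebesgue measure moves the shift from the test function to the
  density. The gap becomes one integral of \<open>k\<close> against a signed density, which can be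
  maximised pointwise.\<close>

lemma std_gaussian_shift_difference:
  fixes k :: "'a::euclidean_space \<Rightarrow> real"
  assumes k[measurable]: "k \<in> borel_measurable borel"
    and k01: "\<And>z. 0 \<le> k z" "\<And>z. k z \<le> 1"
  shows "integrable lborel (\<lambda>z. k z * (gaussian_pdf z - \<gamma> * gaussian_pdf (z - v)))" (is ?I)
    and "(\<integral>z. k z \<partial>std_gaussian) - \<gamma> * (\<integral>z. k (z + v) \<partial>std_gaussian)
      = (\<integral>z. k z * (gaussian_pdf z - \<gamma> * gaussian_pdf (z - v)) \<partial>lborel)" (is ?E)
proof -
  have int: "integrable lborel (\<lambda>z. gaussian_pdf z * f z)"
    if [measurable]: "f \<in> borel_measurable borel" and "\<And>z. 0 \<le> f z" "\<And>z. f z \<le> 1" for f :: "'a \<Rightarrow> real"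
  proof -
    have "integrable std_gaussian f"
      using that by (intro std_gaussian.integrable_const_bound[where B=1]) auto
    then show ?thesis
      unfolding std_gaussian_eq_density
      by (subst (asm) integrable_density) (auto simp: gaussian_pdf_nonneg)
  qed
  have shift: "has_bochner_integral lborel (\<lambda>z. gaussian_pdf (z - v) * k z) (\<integral>z. k (z + v) \<partial>std_gaussian)"
  proof -
    have "has_bochner_integral lborel (\<lambda>z. gaussian_pdf z * k (z + v)) (\<integral>z. gaussian_pdf z * k (z + v) \<partial>lborel)"
      by (intro has_bochner_integral_integrable int) (auto simp: k01)
    also have "(\<integral>z. gaussian_pdf z * k (z + v) \<partial>lborel) = (\<integral>z. k (z + v) \<partial>std_gaussian)"
      unfolding std_gaussian_eq_density by (subst integral_density) (auto simp: gaussian_pdf_nonneg)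
    finally have "has_bochner_integral lborel (\<lambda>z. gaussian_pdf ((v + z) - v) * k (v + z)) (\<integral>z. k (z + v) \<partial>std_gaussian)"
      by (simp add: add.commute)
    then have "has_bochner_integral (distr lborel borel ((+) v)) (\<lambda>z. gaussian_pdf (z - v) * k z) (\<integral>z. k (z + v) \<partial>std_gaussian)"
      by (intro has_bochner_integral_distr) auto
    then show ?thesis by (simp add: lborel_distr_plus)
  qed
  have base: "has_bochner_integral lborel (\<lambda>z. gaussian_pdf z * k z) (\<integral>z. k z \<partial>std_gaussian)"
  proof -
    have "has_bochner_integral lborel (\<lambda>z. gaussian_pdf z * k z) (\<integral>z. gaussian_pdf z * k z \<partial>lborel)"
      by (intro has_bochner_integral_integrable int) (auto simp: k01)
    then show ?thesis
      unfolding std_gaussian_eq_density by (subst integral_density) (auto simp: gaussian_pdf_nonneg)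
  qed
  have "has_bochner_integral lborel (\<lambda>z. gaussian_pdf z * k z - \<gamma> * (gaussian_pdf (z - v) * k z))
     ((\<integral>z. k z \<partial>std_gaussian) - \<gamma> * (\<integral>z. k (z + v) \<partial>std_gaussian))"
    by (intro has_bochner_integral_diff has_bochner_integral_mult_right base shift)
  then have "has_bochner_integral lborel (\<lambda>z. k z * (gaussian_pdf z - \<gamma> * gaussian_pdf (z - v)))
     ((\<integral>z. k z \<partial>std_gaussian) - \<gamma> * (\<integral>z. k (z + v) \<partial>std_gaussian))"
    by (simp add: algebra_simps)
  then show ?I ?E
    by (auto simp: has_bochner_integral_iff)
qed

text \<open>This is the Neyman-Pearson argument: among functions with values in [0,1], the integral
  against the signed density \<open>?q\<close> is largest for the indicator of the set where
  \<open>?q\<close> is nonnegative. That set is a half-space, and its gap is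
  \<open>theta \<gamma> (norm v)\<close>.\<close>

lemma std_gaussian_shift_bound_nonzero:
  fixes k :: "'a::euclidean_space \<Rightarrow> real"
  assumes k[measurable]: "k \<in> borel_measurable borel"
    and k01: "\<And>z. 0 \<le> k z" "\<And>z. k z \<le> 1"
    and \<gamma>: "0 < \<gamma>" and v: "v \<noteq> 0"
  shows "(\<integral>z. k z \<partial>std_gaussian) - \<gamma> * (\<integral>z. k (z + v) \<partial>std_gaussian) \<le> theta \<gamma> (norm v)"
proof -
  let ?q = "\<lambda>z. gaussian_pdf z - \<gamma> * gaussian_pdf (z - v)"
  \<comment> \<open>By the likelihood ratio, \<open>?q z\<close> is nonnegative exactly when
    \<open>ln \<gamma> + z \<bullet> v - (norm v)\<^sup>2 / 2 \<le> 0\<close>. Written with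
    \<open>- v\<close>, this is a half-space of known probability.\<close>
  define A where "A = {z. ln \<gamma> - (norm v)\<^sup>2 / 2 \<le> z \<bullet> - v}"
  have A[measurable]: "A \<in> sets borel" unfolding A_def by measurable
  have q: "?q z = gaussian_pdf z * (1 - exp (ln \<gamma> + (z \<bullet> v - (norm v)\<^sup>2 / 2)))" for z
    using \<gamma> by (simp only: gaussian_pdf_diff exp_add exp_ln) (simp add: algebra_simps)
  have "k z * ?q z \<le> indicator A z * ?q z" for z
  proof (cases "z \<in> A")
    case True
    then have "0 \<le> ?q z"
      unfolding q by (intro mult_nonneg_nonneg gaussian_pdf_nonneg) (simp add: A_def)
    then show ?thesis
      using True k01[of z] by (simp add: mult_left_le_one_le)
  next
    case False
    then have "?q z \<le> 0"
      unfolding q by (intro mult_nonneg_nonpos gaussian_pdf_nonneg) (simp add: A_def)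
    then show ?thesis
      using False k01[of z] by (simp add: mult_nonneg_nonpos)
  qed
  then have "(\<integral>z. k z \<partial>std_gaussian) - \<gamma> * (\<integral>z. k (z + v) \<partial>std_gaussian)
     \<le> (\<integral>z. indicator A z \<partial>std_gaussian) - \<gamma> * (\<integral>z. indicator A (z + v) \<partial>std_gaussian)"
    using k01 by (subst (1 2) std_gaussian_shift_difference(2))
      (auto intro!: integral_mono std_gaussian_shift_difference(1))
  also have "(\<integral>z. indicator A z \<partial>std_gaussian) = measure std_gaussian A"
    by simp
  also have "(\<integral>z. indicator A (z + v) \<partial>std_gaussian) = measure std_gaussian {z. z + v \<in> A}"
  proof -
    have "(\<lambda>z. indicator A (z + v) :: real) = indicator {z. z + v \<in> A}"
      by (auto simp: indicator_def)
    then show ?thesis by simp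
  qed
  \<comment> \<open>The shift raises the threshold by \<open>(norm v)\<^sup>2\<close>, hence the
    opposite signs of \<open>norm v / 2\<close> in the two tails.\<close>
  also have "{z. z + v \<in> A} = {z. ln \<gamma> + (norm v)\<^sup>2 / 2 \<le> z \<bullet> - v}"
    by (auto simp: A_def inner_add_left power2_norm_eq_inner)
  also have "measure std_gaussian \<dots> = gaussian_Q (ln \<gamma> / norm v + norm v / 2)"
    using v by (subst measure_std_gaussian_halfspace) (auto simp: add_divide_distrib power2_eq_square)
  also have "measure std_gaussian A = gaussian_Q (ln \<gamma> / norm v - norm v / 2)"
    unfolding A_def using v
    by (subst measure_std_gaussian_halfspace) (auto simp: diff_divide_distrib power2_eq_square)
  finally show ?thesis
    using v by (simp add: theta_def)
qed

text \<open>For \<open>t\<close> fixed to the threshold that is optimal for \<open>r\<close>, \<open>Q t - \<gamma> Q (t + s)\<close> increases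
  in \<open>s\<close> and is at most \<open>\<theta> s\<close>, being the gap of a half-line.\<close>

lemma theta_pos_mono:
  assumes "0 < \<gamma>" "0 < r" "r \<le> s"
  shows "theta \<gamma> r \<le> theta \<gamma> s"
proof -
  define t where "t = ln \<gamma> / r - r / 2"
  have Q: "measure std_gaussian {z::real. u \<le> z} = gaussian_Q u" for u
    using measure_std_gaussian_halfspace[of "1::real" u] by simp
  have "theta \<gamma> r = gaussian_Q t - \<gamma> * gaussian_Q (t + r)"
    using assms by (simp add: theta_def t_def add.commute)
  also have "\<dots> \<le> gaussian_Q t - \<gamma> * gaussian_Q (t + s)"
    using assms by (intro diff_mono mult_left_mono gaussian_Q_antimono) auto
  also have "\<dots> = (\<integral>z. indicator {t..} z \<partial>std_gaussian) - \<gamma> * (\<integral>z. indicator {t..} (z + - s) \<partial>std_gaussian)"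
  proof -
    have "(\<lambda>z. indicator {t..} (z + - s) :: real) = indicator {z. t + s \<le> z}"
      by (auto simp: indicator_def)
    then show ?thesis by (simp add: Q atLeast_def)
  qed
  also have "\<dots> \<le> theta \<gamma> (norm (- s))"
    using assms by (intro std_gaussian_shift_bound_nonzero) auto
  finally show ?thesis using assms by simp
qed

lemma theta_nonneg:
  assumes "0 < \<gamma>" "0 \<le> r"
  shows "0 \<le> theta \<gamma> r"
  using std_gaussian_shift_bound_nonzero[of "\<lambda>_. 0" \<gamma> r] assms by (cases "r = 0") (auto simp: theta_def)

lemma theta_mono:
  assumes "0 < \<gamma>" "0 \<le> r" "r \<le> s"
  shows "theta \<gamma> r \<le> theta \<gamma> s"
  using theta_pos_mono[of \<gamma> r s] theta_nonneg[of \<gamma> s] assms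
  by (cases "r = 0") (auto simp: theta_def[of \<gamma> 0])

text \<open>The first tail is at most 1 and the subtracted one is strictly positive. Strictness
  makes the final geometric series converge.\<close>

lemma theta_less_1:
  assumes "0 < \<gamma>"
  shows "theta \<gamma> r < 1"
proof (cases "r = 0")
  case False
  have "0 < \<gamma> * gaussian_Q (ln \<gamma> / r + r / 2)"
    using assms gaussian_Q_pos by simp
  then show ?thesis
    using False gaussian_Q_le_1[of "ln \<gamma> / r - r / 2"] by (simp add: theta_def)
qed (simp add: theta_def)

text \<open>Monotonicity of \<open>theta\<close> relaxes the bound at the length of \<open>v\<close>
  to any larger \<open>r\<close>. For \<open>v = 0\<close> the gap is \<open>1 - \<gamma>\<close>
  times a nonnegative integral, hence at most 0.\<close>

lemma std_gaussian_shift_bound: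
  fixes k :: "'a::euclidean_space \<Rightarrow> real"
  assumes k[measurable]: "k \<in> borel_measurable borel"
    and k01: "\<And>z. 0 \<le> k z" "\<And>z. k z \<le> 1"
    and \<gamma>: "1 \<le> \<gamma>" and v: "norm v \<le> r"
  shows "(\<integral>z. k z \<partial>std_gaussian) - \<gamma> * (\<integral>z. k (z + v) \<partial>std_gaussian) \<le> theta \<gamma> r"
proof (cases "v = 0")
  case True
  have "0 \<le> (\<integral>z. k z \<partial>std_gaussian)" by (simp add: k01)
  then have "(\<integral>z. k z \<partial>std_gaussian) - \<gamma> * (\<integral>z. k z \<partial>std_gaussian) \<le> 0"
    using \<gamma> mult_right_mono[of 1 \<gamma> "\<integral>z. k z \<partial>std_gaussian"] by simp
  also have "0 \<le> theta \<gamma> r"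
    using \<gamma> v True by (intro theta_nonneg) auto
  finally show ?thesis using True by simp
next
  case False
  then show ?thesis
    using std_gaussian_shift_bound_nonzero[OF k k01, of \<gamma> v] theta_mono[of \<gamma> "norm v" r] \<gamma> v by simp
qed

subsection \<open>Tangential gradients\<close>

text \<open>In the squared distance from \<open>p + d\<close> to \<open>a\<close>, the cross term
  \<open>d \<bullet> (p - a)\<close> has the same value for all \<open>a\<close> in
  \<open>W\<close>. So the distances from \<open>p\<close> and from \<open>p + d\<close> have the
  same minimiser.\<close>

lemma closest_point_add_orthogonal:
  fixes W :: "'a::euclidean_space set"
  assumes W: "closed W" "convex W" "W \<noteq> {}"
    and d: "\<And>a b. a \<in> W \<Longrightarrow> b \<in> W \<Longrightarrow> d \<bullet> (a - b) = 0"
  shows "closest_point W (p + d) = closest_point W p"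
proof -
  let ?q = "closest_point W p"
  have q: "?q \<in> W" using W by (intro closest_point_in_set)
  have "dist (p + d) ?q \<le> dist (p + d) z" if z: "z \<in> W" for z
  proof -
    have sq: "(dist (p + d) a)\<^sup>2 = (dist p a)\<^sup>2 + 2 * (d \<bullet> (p - a)) + d \<bullet> d" for a
      by (simp add: dist_norm power2_norm_eq_inner inner_diff inner_add inner_commute algebra_simps)
    have "(dist p ?q)\<^sup>2 \<le> (dist p z)\<^sup>2"
      using closest_point_le[OF W(1) z, of p] by (intro power_mono) auto
    moreover have "d \<bullet> (p - ?q) = d \<bullet> (p - z)"
      using d[OF z q] by (simp add: inner_diff_right)
    ultimately have "(dist (p + d) ?q)\<^sup>2 \<le> (dist (p + d) z)\<^sup>2"
      unfolding sq by simp
    then show ?thesis by (rule power2_le_imp_le) simp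
  qed
  then show ?thesis
    using closest_point_unique[OF W(2,1) q, of "p + d"] by simp
qed

text \<open>\<open>V\<close> is the direction space of the affine hull and \<open>c\<close> a point
  of the relative interior, which is nonempty even when the interior of \<open>W\<close> is
  empty.\<close>

lemma convex_tangent_space:
  fixes W :: "'a::euclidean_space set"
  assumes "convex W" "W \<noteq> {}"
  obtains V c r where "subspace V" "c \<in> W" "0 < r"
    "\<And>a b. a \<in> W \<Longrightarrow> b \<in> W \<Longrightarrow> a - b \<in> V"
    "\<And>v. v \<in> V \<Longrightarrow> norm v \<le> r \<Longrightarrow> c + v \<in> W"
proof -
  obtain c where "c \<in> rel_interior W"
    using assms rel_interior_eq_empty by blast
  then obtain r where c: "c \<in> W" and r: "0 < r" and sub: "cball c r \<inter> affine hull W \<subseteq> W"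
    unfolding mem_rel_interior_cball by blast
  define V where "V = span ((\<lambda>x. - c + x) ` (W - {c}))"
  have hull: "affine hull W = (\<lambda>x. c + x) ` V"
    unfolding V_def by (rule affine_hull_span2[OF c])
  have V: "subspace V" unfolding V_def by (rule subspace_span)
  have in_V: "a - c \<in> V" if "a \<in> W" for a
    using that hull_subset[of W affine] hull by auto
  show ?thesis
  proof
    show "a - b \<in> V" if "a \<in> W" "b \<in> W" for a b
      using subspace_diff[OF V in_V[OF that(1)] in_V[OF that(2)]] by simp
    show "c + v \<in> W" if "v \<in> V" "norm v \<le> r" for v
      using that hull sub by (auto simp: dist_norm subset_iff)
  qed fact+
qed

text \<open>On the segment from \<open>w\<close> to \<open>w + h\<close>, which convexity keeps
  inside \<open>W\<close>, the derivative within \<open>W\<close> becomes a one-sided derivative at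
  0.\<close>

lemma directional_difference_quotient:
  fixes f :: "'a::real_inner \<Rightarrow> real"
  assumes f: "(f has_derivative (\<lambda>h. g \<bullet> h)) (at w within W)"
    and W: "convex W" "w \<in> W" "w + h \<in> W"
  shows "(\<lambda>m. (f (w + inverse (real (Suc m)) *\<^sub>R h) - f w) * real (Suc m)) \<longlonglongrightarrow> g \<bullet> h"
proof -
  have line: "w + t *\<^sub>R h \<in> W" if "t \<in> {0..1}" for t :: real
    using convexD[OF W, of "1 - t" t] that by (simp add: algebra_simps)
  have "((\<lambda>t. f (w + t *\<^sub>R h)) has_derivative (\<lambda>t. g \<bullet> (t *\<^sub>R h))) (at 0 within {0..1})"
  proof -
    have d: "((\<lambda>t. w + t *\<^sub>R h) has_derivative (\<lambda>t. t *\<^sub>R h)) (at 0 within {0..1})"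
      by (auto intro!: derivative_eq_intros)
    have "(f has_derivative (\<bullet>) g) (at (w + 0 *\<^sub>R h) within (\<lambda>t. w + t *\<^sub>R h) ` {0..1})"
      using f line by (auto intro: has_derivative_subset)
    from has_derivative_in_compose[OF d this] show ?thesis .
  qed
  then have "((\<lambda>t. f (w + t *\<^sub>R h)) has_field_derivative (g \<bullet> h)) (at 0 within {0..1})"
    unfolding has_field_derivative_def by (simp add: mult_commute_abs)
  then have lim: "((\<lambda>t. (f (w + t *\<^sub>R h) - f w) / t) \<longlongrightarrow> g \<bullet> h) (at 0 within {0..1})"
    by (simp add: has_field_derivative_iff)
  have "filterlim (\<lambda>m. inverse (real (Suc m))) (at 0 within {0..1}) sequentially"
    unfolding filterlim_at using LIMSEQ_inverse_real_of_nat
    by (auto simp: inverse_le_1_iff intro!: always_eventually)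
  from filterlim_compose[OF lim this] show ?thesis
    by (simp add: field_simps)
qed

text \<open>The points \<open>c\<close> and \<open>c + k\<close> of \<open>W\<close> serve all \<open>w\<close> at once, so this limit also makes sense at
  boundary points \<open>w\<close>, where \<open>w + t k\<close> may leave \<open>W\<close> for every \<open>t > 0\<close>.\<close>

lemma tangential_gradient_limit:
  fixes f :: "'a::real_inner \<Rightarrow> real"
  assumes f: "(f has_derivative (\<lambda>h. g \<bullet> h)) (at w within W)"
    and W: "convex W" "w \<in> W" "c \<in> W" "c + k \<in> W"
  shows "(\<lambda>m. (f (w + inverse (real (Suc m)) *\<^sub>R (c + k - w)) -
               f (w + inverse (real (Suc m)) *\<^sub>R (c - w))) * real (Suc m)) \<longlonglongrightarrow> g \<bullet> k"
proof -
  \<comment> \<open>Quotients towards \<open>c + k\<close> and towards \<open>c\<close> are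
    subtracted: \<open>f w\<close> cancels, and in the limit so does \<open>c - w\<close>.\<close>
  have "(\<lambda>m. (f (w + inverse (real (Suc m)) *\<^sub>R (c + k - w)) - f w) * real (Suc m) -
             (f (w + inverse (real (Suc m)) *\<^sub>R (c - w)) - f w) * real (Suc m))
         \<longlonglongrightarrow> g \<bullet> (c + k - w) - g \<bullet> (c - w)"
    by (intro tendsto_diff directional_difference_quotient[OF f W(1,2)]) (use W in auto)
  then show ?thesis
    by (simp add: algebra_simps)
qed

lemma convex_segment_point:
  assumes "convex W" "w \<in> W" "c \<in> W"
  shows "w + inverse (real (Suc m)) *\<^sub>R (c - w) \<in> W"
proof -
  have "w + inverse (real (Suc m)) *\<^sub>R (c - w)
      = (1 - inverse (real (Suc m))) *\<^sub>R w + inverse (real (Suc m)) *\<^sub>R c"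
    by (simp only: algebra_simps scaleR_left.diff scaleR_right.diff) simp
  also have "\<dots> \<in> W"
    by (rule convexD[OF assms]) (auto simp: inverse_le_1_iff)
  finally show ?thesis .
qed

text \<open>The two points compared in the limit differ by \<open>k\<close> divided by
  \<open>m + 1\<close>, so the Lipschitz condition bounds every quotient by
  \<open>L * norm k\<close>.\<close>

lemma tangential_gradient_bound:
  fixes f :: "'a::real_inner \<Rightarrow> real"
  assumes f: "(f has_derivative (\<lambda>h. g \<bullet> h)) (at w within W)"
    and W: "convex W" "w \<in> W" "c \<in> W" "c + k \<in> W"
    and L: "L-lipschitz_on W f"
  shows "g \<bullet> k \<le> L * norm k"
proof (rule LIMSEQ_le_const2[OF tangential_gradient_limit[OF f W]], intro exI allI impI)
  fix m :: nat
  let ?t = "inverse (real (Suc m))"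
  have "f (w + ?t *\<^sub>R (c + k - w)) - f (w + ?t *\<^sub>R (c - w)) \<le> dist (f (w + ?t *\<^sub>R (c + k - w))) (f (w + ?t *\<^sub>R (c - w)))"
    by (simp add: dist_real_def)
  also have "\<dots> \<le> L * dist (w + ?t *\<^sub>R (c + k - w)) (w + ?t *\<^sub>R (c - w))"
    using W by (intro lipschitz_onD[OF L] convex_segment_point)
  also have "dist (w + ?t *\<^sub>R (c + k - w)) (w + ?t *\<^sub>R (c - w)) = ?t * norm k"
    by (simp add: dist_norm scaleR_right.diff[symmetric])
  finally show "(f (w + ?t *\<^sub>R (c + k - w)) - f (w + ?t *\<^sub>R (c - w))) * real (Suc m) \<le> L * norm k"
    by (simp add: field_simps)
qed

lemma tangential_gradient_measurable:
  fixes f :: "'a::euclidean_space \<Rightarrow> real"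
  assumes f: "\<And>w. w \<in> W \<Longrightarrow> (f has_derivative (\<lambda>h. g w \<bullet> h)) (at w within W)"
    and W: "convex W" "c \<in> W" "c + k \<in> W"
  shows "(\<lambda>w. g w \<bullet> k) \<in> borel_measurable (restrict_space borel W)"
proof (rule borel_measurable_LIMSEQ_real)
  fix w assume "w \<in> space (restrict_space borel W)"
  then show "(\<lambda>m. (f (w + inverse (real (Suc m)) *\<^sub>R (c + k - w)) -
               f (w + inverse (real (Suc m)) *\<^sub>R (c - w))) * real (Suc m)) \<longlonglongrightarrow> g w \<bullet> k"
    using W by (intro tangential_gradient_limit[OF f]) (auto simp: space_restrict_space)
next
  fix m :: nat
  have "continuous_on W f"
    using has_derivative_continuous[OF f] by (simp add: continuous_on_eq_continuous_within)
  then have cont: "continuous_on W (\<lambda>w. f (w + inverse (real (Suc m)) *\<^sub>R (a - w)))" if "a \<in> W" for a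
    by (rule continuous_on_compose2)
      (use that W(1) in \<open>auto intro!: continuous_intros convex_segment_point simp del: of_nat_Suc\<close>)
  show "(\<lambda>w. (f (w + inverse (real (Suc m)) *\<^sub>R (c + k - w)) -
               f (w + inverse (real (Suc m)) *\<^sub>R (c - w))) * real (Suc m))
       \<in> borel_measurable (restrict_space borel W)"
    by (intro borel_measurable_continuous_on_restrict continuous_on_mult continuous_on_diff
        continuous_on_const cont W)
qed

lemma tangential_gradient:
  fixes f :: "'a::euclidean_space \<Rightarrow> real"
  assumes W: "convex W" "W \<noteq> {}"
    and f: "\<And>w. w \<in> W \<Longrightarrow> (f has_derivative (\<lambda>h. g w \<bullet> h)) (at w within W)"
    and L: "L-lipschitz_on W f"
  obtains gT where "gT \<in> borel_measurable (restrict_space borel W)"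
    "\<And>w. w \<in> W \<Longrightarrow> norm (gT w) \<le> L"
    "\<And>w a b. w \<in> W \<Longrightarrow> a \<in> W \<Longrightarrow> b \<in> W \<Longrightarrow> (g w - gT w) \<bullet> (a - b) = 0"
proof -
  obtain V c r where V: "subspace V" and c: "c \<in> W" and r: "0 < r"
    and diff: "\<And>a b. a \<in> W \<Longrightarrow> b \<in> W \<Longrightarrow> a - b \<in> V"
    and ball: "\<And>v. v \<in> V \<Longrightarrow> norm v \<le> r \<Longrightarrow> c + v \<in> W"
    using convex_tangent_space[OF W] by metis
  obtain B where B: "B \<subseteq> V" "pairwise orthogonal B" "\<And>b. b \<in> B \<Longrightarrow> norm b = 1"
    "independent B" "span B = V"
    using orthonormal_basis_subspace[OF V] by metis
  have finB: "finite B" using B(4) by (rule independent_imp_finite)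
  \<comment> \<open>This is the orthogonal projection of \<open>g w\<close> onto \<open>V\<close>,
    written in an orthonormal basis.\<close>
  define gT where "gT w = (\<Sum>b\<in>B. (g w \<bullet> b) *\<^sub>R b)" for w
  have gT_V: "gT w \<in> V" for w
    unfolding gT_def using B(1) V by (intro subspace_sum subspace_scale) auto
  \<comment> \<open>Rescaling to length \<open>r\<close> makes every direction in \<open>V\<close>
    usable as the \<open>k\<close> of the preceding lemmas; for \<open>v = 0\<close>, division by
    zero leaves the point \<open>c\<close>.\<close>
  have scaled: "c + (r / norm v) *\<^sub>R v \<in> W" if "v \<in> V" for v
    using that r V by (intro ball subspace_scale) auto
  have orth: "(g w - gT w) \<bullet> v = 0" if "v \<in> V" for v w
  proof -
    have basis: "gT w \<bullet> b = g w \<bullet> b" if "b \<in> B" for b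
    proof -
      have "gT w \<bullet> b = (\<Sum>b'\<in>B. if b' = b then g w \<bullet> b else 0)"
        unfolding gT_def inner_sum_left using that B(2,3)
        by (intro sum.cong) (auto simp: pairwise_def orthogonal_def norm_eq_1)
      then show ?thesis using that finB by simp
    qed
    have "v \<in> span B" using that B(5) by simp
    then show ?thesis
      by (induct rule: span_induct_alt) (auto simp: inner_add_right inner_diff_left basis)
  qed
  show ?thesis
  proof
    have "(\<lambda>w. g w \<bullet> b) \<in> borel_measurable (restrict_space borel W)" if "b \<in> B" for b
    proof -
      have "(\<lambda>w. g w \<bullet> (r *\<^sub>R b)) \<in> borel_measurable (restrict_space borel W)"
        using scaled[of b] that B(1,3)
        by (intro tangential_gradient_measurable[OF f W(1) c]) auto
      then have "(\<lambda>w. inverse r * (g w \<bullet> (r *\<^sub>R b))) \<in> borel_measurable (restrict_space borel W)"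
        by measurable
      then show ?thesis using r by (simp add: mult.assoc[symmetric])
    qed
    then show "gT \<in> borel_measurable (restrict_space borel W)"
      unfolding gT_def by measurable
    show "(g w - gT w) \<bullet> (a - b) = 0" if "w \<in> W" "a \<in> W" "b \<in> W" for w a b
      using orth diff that by blast
    show "norm (gT w) \<le> L" if w: "w \<in> W" for w
    proof (cases "gT w = 0")
      case True
      then show ?thesis using lipschitz_on_nonneg[OF L] by simp
    next
      case False
      \<comment> \<open>The gradient is tested in the direction of its own projection:
        \<open>g w \<bullet> gT w\<close> is the squared norm of \<open>gT w\<close>, so the
        directional bound becomes a norm bound.\<close>
      let ?k = "(r / norm (gT w)) *\<^sub>R gT w"
      have "g w \<bullet> ?k \<le> L * norm ?k"
        using tangential_gradient_bound[OF f[OF w] W(1) w c scaled[OF gT_V] L] .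
      moreover have "g w \<bullet> gT w = (norm (gT w))\<^sup>2"
        using orth[OF gT_V[of w], of w] by (simp add: inner_diff_left power2_norm_eq_inner)
      ultimately show ?thesis
        using False r by (simp add: power2_eq_square)
    qed
  qed
qed

subsection \<open>Contraction by a noisy step\<close>

text \<open>Indicators of events would not suffice: averaging an indicator over the noise leaves a
  function with values between 0 and 1.\<close>

definition test_function :: "'a::euclidean_space set \<Rightarrow> ('a \<Rightarrow> real) \<Rightarrow> bool" where
  "test_function W k \<longleftrightarrow>
     k \<in> borel_measurable (restrict_space borel W) \<and> (\<forall>w\<in>W. 0 \<le> k w \<and> k w \<le> 1)"

lemma test_function_integrable:
  assumes "prob_space M" and M: "f \<in> measurable M (restrict_space borel W)"
    and k: "test_function W k"
  shows "integrable M (\<lambda>x. k (f x))"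
proof -
  interpret prob_space M by fact
  have "f x \<in> W" if "x \<in> space M" for x
    using measurable_space[OF M that] by (simp add: space_restrict_space)
  then show ?thesis
    using measurable_compose[OF M, of k borel] k
    by (intro integrable_const_bound[where B=1] AE_I2) (auto simp: test_function_def)
qed

text \<open>Let \<open>lo\<close> and \<open>hi\<close> be the infimum and supremum of
  \<open>h\<close> on \<open>W\<close>. Rescaling \<open>h\<close> to values in [0,1] turns the left
  side into \<open>hi - lo\<close> times a gap of at most \<open>a\<close>, minus
  \<open>(\<gamma> - 1) * lo\<close>. As \<open>a \<le> 1\<close>, this is at most
  \<open>a * (hi - \<gamma> * lo)\<close>, and the oscillation bound gives
  \<open>hi - \<gamma> * lo \<le> c\<close>.\<close>

lemma test_function_contraction:
  fixes W :: "'a::euclidean_space set"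
  assumes M: "prob_space M" "sets M = sets (restrict_space borel W)"
    and N: "prob_space N" "sets N = sets (restrict_space borel W)"
    and W: "W \<noteq> {}" and \<gamma>: "1 \<le> \<gamma>" and a: "a \<le> 1"
    and bound: "\<And>k. test_function W k \<Longrightarrow> (\<integral>w. k w \<partial>M) - \<gamma> * (\<integral>w. k w \<partial>N) \<le> a"
    and h: "test_function W h"
    and osc: "\<And>y y'. y \<in> W \<Longrightarrow> y' \<in> W \<Longrightarrow> h y - \<gamma> * h y' \<le> c"
  shows "(\<integral>w. h w \<partial>M) - \<gamma> * (\<integral>w. h w \<partial>N) \<le> a * c"
proof -
  define lo where "lo = (INF y\<in>W. h y)"
  define hi where "hi = (SUP y\<in>W. h y)"
  have h01: "0 \<le> h w" "h w \<le> 1" if "w \<in> W" for w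
    using h that by (auto simp: test_function_def)
  have lo: "lo \<le> h w" if "w \<in> W" for w
    unfolding lo_def using that h01 by (intro cINF_lower bdd_belowI[of _ 0]) auto
  have hi: "h w \<le> hi" if "w \<in> W" for w
    unfolding hi_def using that h01 by (intro cSUP_upper bdd_aboveI[of _ 1]) auto
  have "0 \<le> lo" unfolding lo_def using W h01 by (intro cINF_greatest) auto
  have "(h y - c) / \<gamma> \<le> lo" if "y \<in> W" for y
    unfolding lo_def using W osc[OF that] \<gamma> by (intro cINF_greatest) (auto simp: field_simps)
  then have "h y \<le> c + \<gamma> * lo" if "y \<in> W" for y
    using that \<gamma> by (simp add: field_simps)
  then have "hi \<le> c + \<gamma> * lo"
    unfolding hi_def using W by (intro cSUP_least) auto
  obtain w0 where "w0 \<in> W" using W by blast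
  have "lo \<le> hi" using lo[OF \<open>w0 \<in> W\<close>] hi[OF \<open>w0 \<in> W\<close>] by simp
  \<comment> \<open>If \<open>hi = lo\<close>, division by zero makes \<open>k\<close> zero, and
    \<open>h = lo + (hi - lo) * k\<close> still holds on \<open>W\<close>.\<close>
  define k where "k w = (h w - lo) / (hi - lo)" for w
  have k: "test_function W k"
    using h lo hi \<open>lo \<le> hi\<close> unfolding test_function_def k_def
    by (auto simp: divide_le_eq_1)
  have hk: "h w = lo + (hi - lo) * k w" if "w \<in> W" for w
    using lo[OF that] hi[OF that] by (cases "hi = lo") (auto simp: k_def)
  have lin: "(\<integral>w. h w \<partial>K) = lo + (hi - lo) * (\<integral>w. k w \<partial>K)"
    if "prob_space K" and sets: "sets K = sets (restrict_space borel W)" for K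
  proof -
    interpret K: prob_space K by fact
    have [measurable]: "(\<lambda>x. x) \<in> measurable K (restrict_space borel W)"
      using sets by (simp add: measurable_ident_sets)
    have "integrable K k"
      using test_function_integrable[OF that(1) _ k, of "\<lambda>x. x"] by simp
    have "(\<integral>w. h w \<partial>K) = (\<integral>w. lo + (hi - lo) * k w \<partial>K)"
      using sets_eq_imp_space_eq[OF sets] hk
      by (intro Bochner_Integration.integral_cong) (auto simp: space_restrict_space)
    also have "\<dots> = lo + (hi - lo) * (\<integral>w. k w \<partial>K)"
      using \<open>integrable K k\<close> by (simp add: K.prob_space)
    finally show ?thesis .
  qed
  have "0 \<le> a"
    using bound[of "\<lambda>_. 0"] by (simp add: test_function_def)
  have "(\<integral>w. h w \<partial>M) - \<gamma> * (\<integral>w. h w \<partial>N)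
      = (hi - lo) * ((\<integral>w. k w \<partial>M) - \<gamma> * (\<integral>w. k w \<partial>N)) - (\<gamma> - 1) * lo"
    unfolding lin[OF M] lin[OF N] by (simp add: algebra_simps)
  also have "\<dots> \<le> (hi - lo) * a - (\<gamma> - 1) * lo"
    using bound[OF k] \<open>lo \<le> hi\<close> \<gamma> by (intro diff_mono mult_left_mono) auto
  also have "\<dots> \<le> (hi - lo) * a - a * ((\<gamma> - 1) * lo)"
    using \<gamma> a \<open>0 \<le> lo\<close> by (simp add: mult_left_le_one_le \<open>0 \<le> a\<close>)
  also have "\<dots> = a * (hi - \<gamma> * lo)"
    by (simp add: algebra_simps)
  also have "\<dots> \<le> a * c"
    using \<open>hi \<le> c + \<gamma> * lo\<close> \<open>0 \<le> a\<close> by (intro mult_left_mono) auto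
  finally show ?thesis .
qed

lemma pnsgd_iterate_cong:
  assumes "\<And>s. s \<in> {1..t} \<Longrightarrow> x s = x' s" "\<And>s. s \<in> {1..t} \<Longrightarrow> z s = z' s"
  shows "pnsgd_iterate W \<eta> \<sigma> g x w z t = pnsgd_iterate W \<eta> \<sigma> g x' w z' t"
  using assms by (induct t) (auto simp: Let_def)

section \<open>The projected noisy gradient step\<close>

locale noisy_sgd =
  fixes W :: "'a::euclidean_space set" and X :: "'x set" and grad :: "'a \<Rightarrow> 'x \<Rightarrow> 'a"
    and L \<eta> \<sigma> :: real
  assumes closed: "closed W" and convex: "convex W" and nonempty: "W \<noteq> {}"
    and \<eta>_pos: "0 < \<eta>" and \<sigma>_pos: "0 < \<sigma>"
    and tangential: "\<And>x. x \<in> X \<Longrightarrow> \<exists>gT\<in>borel_measurable (restrict_space borel W).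
      (\<forall>w\<in>W. norm (gT w) \<le> L) \<and> (\<forall>w\<in>W. \<forall>a\<in>W. \<forall>b\<in>W. (grad w x - gT w) \<bullet> (a - b) = 0)"
begin

definition step :: "'x \<Rightarrow> 'a \<Rightarrow> 'a \<Rightarrow> 'a" where
  "step x w z = closest_point W (w - \<eta> *\<^sub>R (grad w x + \<sigma> *\<^sub>R z))"

text \<open>The Markov operator of one step: it carries a test function back from the iterate after
  the step to the one before it.\<close>

definition noise_average :: "'x \<Rightarrow> ('a \<Rightarrow> real) \<Rightarrow> 'a \<Rightarrow> real" where
  "noise_average x k w = (\<integral>z. k (step x w z) \<partial>std_gaussian)"

text \<open>Replacing \<open>grad\<close> by \<open>gT\<close> moves the point to be projected
  orthogonally to all differences of points of \<open>W\<close>, which the projection ignores.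
  Bounds and measurability of the step can then be taken from \<open>gT\<close>.\<close>

lemma step_tangential:
  assumes "x \<in> X"
  obtains gT where "gT \<in> borel_measurable (restrict_space borel W)"
    "\<And>w. w \<in> W \<Longrightarrow> norm (gT w) \<le> L"
    "\<And>w z. w \<in> W \<Longrightarrow> step x w z = closest_point W ((w - \<eta> *\<^sub>R gT w) - (\<eta> * \<sigma>) *\<^sub>R z)"
proof -
  obtain gT where gT: "gT \<in> borel_measurable (restrict_space borel W)" "\<And>w. w \<in> W \<Longrightarrow> norm (gT w) \<le> L"
    and orth: "\<And>w a b. w \<in> W \<Longrightarrow> a \<in> W \<Longrightarrow> b \<in> W \<Longrightarrow> (grad w x - gT w) \<bullet> (a - b) = 0"
    using tangential[OF assms] by blast
  show ?thesis
  proof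
    fix w z assume w: "w \<in> W"
    let ?p = "(w - \<eta> *\<^sub>R gT w) - (\<eta> * \<sigma>) *\<^sub>R z" and ?d = "- \<eta> *\<^sub>R (grad w x - gT w)"
    have "w - \<eta> *\<^sub>R (grad w x + \<sigma> *\<^sub>R z) = ?p + ?d"
      by (simp add: algebra_simps)
    moreover have "closest_point W (?p + ?d) = closest_point W ?p"
      using orth[OF w] by (intro closest_point_add_orthogonal closed convex nonempty) simp
    ultimately show "step x w z = closest_point W ?p"
      unfolding step_def by (simp only:)
  qed (use gT in auto)
qed

lemma closest_point_measurable [measurable]:
  "closest_point W \<in> measurable borel (restrict_space borel W)"
  by (intro measurable_restrict_space2 borel_measurable_continuous_onI
      continuous_on_closest_point closed convex nonempty)
    (use closest_point_in_set[OF closed nonempty] in auto)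

lemma step_measurable:
  assumes "x \<in> X"
  shows "(\<lambda>(w, z). step x w z) \<in> measurable (restrict_space borel W \<Otimes>\<^sub>M borel) (restrict_space borel W)"
proof -
  obtain gT where [measurable]: "gT \<in> borel_measurable (restrict_space borel W)"
    and st: "\<And>w z. w \<in> W \<Longrightarrow> step x w z = closest_point W ((w - \<eta> *\<^sub>R gT w) - (\<eta> * \<sigma>) *\<^sub>R z)"
    using step_tangential[OF assms] by metis
  have [measurable]: "(\<lambda>w. w) \<in> measurable (restrict_space borel W) borel"
    by (rule measurable_restrict_space1) simp
  have "(\<lambda>(w, z). closest_point W ((w - \<eta> *\<^sub>R gT w) - (\<eta> * \<sigma>) *\<^sub>R z))
      \<in> measurable (restrict_space borel W \<Otimes>\<^sub>M borel) (restrict_space borel W)"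
    by measurable
  then show ?thesis
    by (rule measurable_cong[THEN iffD2, rotated])
      (auto simp: st space_pair_measure space_restrict_space)
qed

text \<open>Adding \<open>(m - m') / (\<eta> * \<sigma>)\<close> to the noise turns the mean
  \<open>m\<close> into \<open>m'\<close>, so this is the shift bound for \<open>k\<close> composed
  with the projection.\<close>

lemma projected_gaussian_bound:
  assumes k: "test_function W k" and \<gamma>: "1 \<le> \<gamma>" and m: "norm (m - m') \<le> \<eta> * \<sigma> * r"
  shows "(\<integral>z. k (closest_point W (m - (\<eta> * \<sigma>) *\<^sub>R z)) \<partial>std_gaussian)
     - \<gamma> * (\<integral>z. k (closest_point W (m' - (\<eta> * \<sigma>) *\<^sub>R z)) \<partial>std_gaussian) \<le> theta \<gamma> r"
proof -
  let ?k = "\<lambda>z. k (closest_point W (m - (\<eta> * \<sigma>) *\<^sub>R z))"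
  let ?v = "inverse (\<eta> * \<sigma>) *\<^sub>R (m - m')"
  have [measurable]: "k \<in> borel_measurable (restrict_space borel W)"
    using k by (simp add: test_function_def)
  have "closest_point W p \<in> W" for p
    by (rule closest_point_in_set[OF closed nonempty])
  moreover have "norm ?v \<le> r"
  proof -
    have "norm ?v = norm (m - m') / (\<eta> * \<sigma>)"
      using \<eta>_pos \<sigma>_pos by (simp add: divide_inverse)
    also have "\<dots> \<le> r"
      using m \<eta>_pos \<sigma>_pos by (simp add: pos_divide_le_eq mult.commute)
    finally show ?thesis .
  qed
  ultimately have "(\<integral>z. ?k z \<partial>std_gaussian) - \<gamma> * (\<integral>z. ?k (z + ?v) \<partial>std_gaussian) \<le> theta \<gamma> r"
    using k by (intro std_gaussian_shift_bound \<gamma>) (auto simp: test_function_def)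
  moreover have "?k (z + ?v) = k (closest_point W (m' - (\<eta> * \<sigma>) *\<^sub>R z))" for z
  proof -
    have ne: "\<eta> * \<sigma> \<noteq> 0" using \<eta>_pos \<sigma>_pos by simp
    have "m - (\<eta> * \<sigma>) *\<^sub>R (z + ?v) = m' - (\<eta> * \<sigma>) *\<^sub>R z"
      by (simp only: scaleR_add_right scaleR_scaleR right_inverse[OF ne] scaleR_one) simp
    then show ?thesis by (simp only:)
  qed
  ultimately show ?thesis by simp
qed

text \<open>From a common point \<open>w\<close>, the two means differ by \<open>\<eta>\<close>
  times a difference of two vectors of norm at most \<open>L\<close>. In units of the noise scale
  \<open>\<eta> * \<sigma>\<close> this is at most \<open>2 * L / \<sigma>\<close>.\<close>

lemma noise_average_data_bound:
  assumes k: "test_function W k" and \<gamma>: "1 \<le> \<gamma>" and "x \<in> X" "x' \<in> X" and w: "w \<in> W"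
  shows "noise_average x k w - \<gamma> * noise_average x' k w \<le> theta \<gamma> (2 * L / \<sigma>)"
proof -
  obtain g where g: "\<And>w. w \<in> W \<Longrightarrow> norm (g w) \<le> L"
    and st: "\<And>w z. w \<in> W \<Longrightarrow> step x w z = closest_point W ((w - \<eta> *\<^sub>R g w) - (\<eta> * \<sigma>) *\<^sub>R z)"
    using step_tangential[OF \<open>x \<in> X\<close>] by metis
  obtain g' where g': "\<And>w. w \<in> W \<Longrightarrow> norm (g' w) \<le> L"
    and st': "\<And>w z. w \<in> W \<Longrightarrow> step x' w z = closest_point W ((w - \<eta> *\<^sub>R g' w) - (\<eta> * \<sigma>) *\<^sub>R z)"
    using step_tangential[OF \<open>x' \<in> X\<close>] by metis
  have "norm ((w - \<eta> *\<^sub>R g w) - (w - \<eta> *\<^sub>R g' w)) = \<eta> * norm (g' w - g w)"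
    using \<eta>_pos by (simp add: scaleR_diff_right[symmetric])
  also have "\<dots> \<le> \<eta> * (L + L)"
    using g[OF w] g'[OF w] norm_triangle_ineq4[of "g' w" "g w"] \<eta>_pos by (intro mult_left_mono) auto
  also have "\<dots> = \<eta> * \<sigma> * (2 * L / \<sigma>)"
    using \<sigma>_pos by simp
  finally show ?thesis
    unfolding noise_average_def st[OF w] st'[OF w] by (rule projected_gaussian_bound[OF k \<gamma>])
qed

text \<open>With a common data point, the means differ by \<open>w - w'\<close>, which the diameter
  bounds, and by two gradient steps of length at most \<open>\<eta> * L\<close> each. This is the
  oscillation bound that \<open>test_function_contraction\<close> asks for.\<close>

lemma noise_average_oscillation:
  assumes k: "test_function W k" and \<gamma>: "1 \<le> \<gamma>" and x: "x \<in> X" and w: "w \<in> W" "w' \<in> W"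
    and W: "bounded W"
  shows "noise_average x k w - \<gamma> * noise_average x k w'
     \<le> theta \<gamma> ((diameter W + 2 * \<eta> * L) / (\<eta> * \<sigma>))"
proof -
  obtain g where g: "\<And>w. w \<in> W \<Longrightarrow> norm (g w) \<le> L"
    and st: "\<And>w z. w \<in> W \<Longrightarrow> step x w z = closest_point W ((w - \<eta> *\<^sub>R g w) - (\<eta> * \<sigma>) *\<^sub>R z)"
    using step_tangential[OF x] by metis
  have "norm ((w - \<eta> *\<^sub>R g w) - (w' - \<eta> *\<^sub>R g w')) = norm ((w - w') + \<eta> *\<^sub>R (g w' - g w))"
    by (simp add: algebra_simps)
  also have "\<dots> \<le> norm (w - w') + \<eta> * norm (g w' - g w)"
    using \<eta>_pos norm_triangle_ineq[of "w - w'" "\<eta> *\<^sub>R (g w' - g w)"] by simp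
  also have "\<dots> \<le> diameter W + \<eta> * (L + L)"
    using g[OF w(1)] g[OF w(2)] norm_triangle_ineq4[of "g w'" "g w"] \<eta>_pos
      diameter_bounded_bound[OF W w]
    by (intro add_mono mult_left_mono) (auto simp: dist_norm)
  also have "\<dots> = \<eta> * \<sigma> * ((diameter W + 2 * \<eta> * L) / (\<eta> * \<sigma>))"
    using \<sigma>_pos \<eta>_pos by simp
  finally show ?thesis
    unfolding noise_average_def st[OF w(1)] st[OF w(2)] by (rule projected_gaussian_bound[OF k \<gamma>])
qed

lemma test_function_noise_average:
  assumes k: "test_function W k" and x: "x \<in> X"
  shows "test_function W (noise_average x k)"
  unfolding test_function_def
proof (intro conjI ballI)
  have [measurable]: "k \<in> borel_measurable (restrict_space borel W)"
    using k by (simp add: test_function_def)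
  note step_measurable[OF x, measurable]
  show "noise_average x k \<in> borel_measurable (restrict_space borel W)"
    unfolding noise_average_def by measurable
  fix w assume w: "w \<in> W"
  have st: "step x w z \<in> W" for z
    unfolding step_def by (rule closest_point_in_set[OF closed nonempty])
  then show "0 \<le> noise_average x k w"
    using k by (auto simp: noise_average_def test_function_def)
  have "integrable std_gaussian (\<lambda>z. k (step x w z))"
  proof (rule test_function_integrable[OF std_gaussian_prob _ k])
    show "step x w \<in> measurable std_gaussian (restrict_space borel W)"
      using measurable_Pair2[OF step_measurable[OF x], of w] w
      by (simp add: space_restrict_space cong: measurable_cong_sets)
  qed
  then show "noise_average x k w \<le> 1"
    unfolding noise_average_def using st k
    by (intro std_gaussian.integral_le_const) (auto simp: test_function_def)
qed

end

subsection \<open>Laws of the iterates\<close>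

abbreviation noise :: "nat \<Rightarrow> (nat \<Rightarrow> 'a::euclidean_space) measure" where
  "noise n \<equiv> \<Pi>\<^sub>M t\<in>{1..n}. std_gaussian"

lemma prob_space_noise: "prob_space (noise n :: (nat \<Rightarrow> 'a::euclidean_space) measure)"
  by (intro prob_space_PiM std_gaussian_prob)

context noisy_sgd
begin

lemma pnsgd_iterate_Suc:
  "pnsgd_iterate W \<eta> \<sigma> grad x w z (Suc t) =
     step (x (Suc t)) (pnsgd_iterate W \<eta> \<sigma> grad x w z t) (z (Suc t))"
  by (simp add: step_def Let_def)

lemma pnsgd_iterate_measurable:
  assumes x: "x \<in> {1..n} \<rightarrow> X" and "t \<le> n"
  shows "(\<lambda>(w, z). pnsgd_iterate W \<eta> \<sigma> grad x w z t)
    \<in> measurable (restrict_space borel W \<Otimes>\<^sub>M noise n) (restrict_space borel W)"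
  using \<open>t \<le> n\<close>
proof (induct t)
  case 0
  then show ?case by simp
next
  case (Suc t)
  then have "x (Suc t) \<in> X" using x by auto
  have "(\<lambda>z. z (Suc t)) \<in> measurable (noise n) borel"
    using Suc.prems measurable_component_singleton[of "Suc t" "{1..n}" "\<lambda>_. std_gaussian"]
    by (simp cong: measurable_cong_sets)
  from measurable_compose[OF measurable_snd this]
  have "(\<lambda>p. (pnsgd_iterate W \<eta> \<sigma> grad x (fst p) (snd p) t, snd p (Suc t)))
      \<in> measurable (restrict_space borel W \<Otimes>\<^sub>M noise n) (restrict_space borel W \<Otimes>\<^sub>M borel)"
    using Suc by (intro measurable_Pair) (simp_all add: case_prod_unfold)
  from measurable_compose[OF this step_measurable[OF \<open>x (Suc t) \<in> X\<close>]] show ?case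
    by (simp only: pnsgd_iterate_Suc case_prod_unfold fst_conv snd_conv)
qed

text \<open>The law of the output given \<open>T = t\<close>. All \<open>n\<close> noise variables
  are kept for every \<open>t\<close>, so that the laws for different \<open>t\<close> come from one
  product space.\<close>

definition iterate_law :: "'a measure \<Rightarrow> nat \<Rightarrow> (nat \<Rightarrow> 'x) \<Rightarrow> nat \<Rightarrow> 'a measure" where
  "iterate_law \<mu> n x t =
     distr (\<mu> \<Otimes>\<^sub>M noise n) (restrict_space borel W) (\<lambda>(w, z). pnsgd_iterate W \<eta> \<sigma> grad x w z t)"

context
  fixes \<mu> :: "'a measure" and n :: nat
  assumes \<mu>: "prob_space \<mu>" and sets_\<mu>: "sets \<mu> = sets (restrict_space borel W)"
begin

interpretation \<mu>: prob_space \<mu> by (rule \<mu>)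
interpretation noise: prob_space "noise n :: (nat \<Rightarrow> 'a) measure" by (rule prob_space_noise)
interpretation start: pair_prob_space \<mu> "noise n :: (nat \<Rightarrow> 'a) measure" ..

lemma pnsgd_iterate_measurable_start:
  assumes "x \<in> {1..n} \<rightarrow> X" "t \<le> n"
  shows "(\<lambda>(w, z). pnsgd_iterate W \<eta> \<sigma> grad x w z t) \<in> measurable (\<mu> \<Otimes>\<^sub>M noise n) (restrict_space borel W)"
proof -
  have "sets (\<mu> \<Otimes>\<^sub>M noise n) = sets (restrict_space borel W \<Otimes>\<^sub>M noise n)"
    by (rule sets_pair_measure_cong[OF sets_\<mu> refl])
  then show ?thesis
    by (subst measurable_cong_sets[OF _ refl]) (assumption, rule pnsgd_iterate_measurable[OF assms])
qed

lemma prob_space_iterate_law: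
  assumes "x \<in> {1..n} \<rightarrow> X" "t \<le> n"
  shows "prob_space (iterate_law \<mu> n x t)"
  unfolding iterate_law_def by (rule start.P.prob_space_distr[OF pnsgd_iterate_measurable_start[OF assms]])

lemma sets_iterate_law: "sets (iterate_law \<mu> n x t) = sets (restrict_space borel W)"
  by (simp add: iterate_law_def)

lemma integral_iterate_law:
  assumes x: "x \<in> {1..n} \<rightarrow> X" and t: "t \<le> n" and k: "test_function W k"
  shows "(\<integral>w. k w \<partial>iterate_law \<mu> n x t)
    = (\<integral>w. (\<integral>z. k (pnsgd_iterate W \<eta> \<sigma> grad x w z t) \<partial>noise n) \<partial>\<mu>)"
proof -
  note meas = pnsgd_iterate_measurable_start[OF x t]
  have "integrable (\<mu> \<Otimes>\<^sub>M noise n) (\<lambda>p. k (case p of (w, z) \<Rightarrow> pnsgd_iterate W \<eta> \<sigma> grad x w z t))"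
    by (rule test_function_integrable[OF _ meas k]) (rule start.P.prob_space_axioms)
  from start.integral_fst'[OF this] show ?thesis
    unfolding iterate_law_def using k
    by (subst integral_distr[OF meas]) (auto simp: test_function_def)
qed

text \<open>The noise variable of index \<open>Suc t\<close> is integrated first. The iterate at
  \<open>t\<close> does not depend on it, so the inner integral is \<open>noise_average\<close> on
  the left and that of a constant on the right.\<close>

lemma noise_average_pnsgd_iterate:
  assumes x: "x \<in> {1..n} \<rightarrow> X" and t: "Suc t \<le> n" and k: "test_function W k" and w: "w \<in> W"
  shows "(\<integral>z. k (pnsgd_iterate W \<eta> \<sigma> grad x w z (Suc t)) \<partial>noise n)
    = (\<integral>z. noise_average (x (Suc t)) k (pnsgd_iterate W \<eta> \<sigma> grad x w z t) \<partial>noise n)"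
proof -
  interpret product_sigma_finite "\<lambda>_::nat. std_gaussian :: 'a measure" ..
  define I where "I = {1..n} - {Suc t}"
  have I: "finite I" "Suc t \<notin> I" "{1..n} = insert (Suc t) I"
    using t by (auto simp: I_def)
  have k': "test_function W (noise_average (x (Suc t)) k)"
    using t x by (intro test_function_noise_average k) auto
  have fold: "(\<integral>z. h (pnsgd_iterate W \<eta> \<sigma> grad x w z s) \<partial>noise n)
    = (\<integral>z. (\<integral>y. h (pnsgd_iterate W \<eta> \<sigma> grad x w (z(Suc t := y)) s) \<partial>std_gaussian)
        \<partial>(\<Pi>\<^sub>M i\<in>I. std_gaussian))"
    if "test_function W h" "s \<le> n" for h s
    unfolding I(3)
  proof (rule product_integral_insert[OF I(1,2)], fold I(3),
      rule test_function_integrable[OF prob_space_noise _ that(1)])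
    show "(\<lambda>z. pnsgd_iterate W \<eta> \<sigma> grad x w z s) \<in> measurable (noise n) (restrict_space borel W)"
      using measurable_Pair2[OF pnsgd_iterate_measurable[OF x that(2)], of w] w
      by (simp add: space_restrict_space)
  qed
  have past: "pnsgd_iterate W \<eta> \<sigma> grad x w (z(Suc t := y)) t = pnsgd_iterate W \<eta> \<sigma> grad x w z t" for z y
    by (rule pnsgd_iterate_cong) auto
  have "(\<integral>z. k (pnsgd_iterate W \<eta> \<sigma> grad x w z (Suc t)) \<partial>noise n)
    = (\<integral>z. noise_average (x (Suc t)) k (pnsgd_iterate W \<eta> \<sigma> grad x w z t) \<partial>(\<Pi>\<^sub>M i\<in>I. std_gaussian))"
    by (subst fold[OF k t]) (simp only: pnsgd_iterate_Suc past fun_upd_same noise_average_def)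
  also have "\<dots> = (\<integral>z. noise_average (x (Suc t)) k (pnsgd_iterate W \<eta> \<sigma> grad x w z t) \<partial>noise n)"
    by (subst fold[OF k' Suc_leD[OF t]]) (simp add: past std_gaussian.prob_space[simplified])
  finally show ?thesis .
qed

text \<open>Pushing the law forward by a step is dual to averaging the test function backwards; this
  moves a comparison of two laws one step back in time.\<close>

lemma integral_iterate_law_Suc:
  assumes x: "x \<in> {1..n} \<rightarrow> X" and t: "Suc t \<le> n" and k: "test_function W k"
  shows "(\<integral>w. k w \<partial>iterate_law \<mu> n x (Suc t)) = (\<integral>w. noise_average (x (Suc t)) k w \<partial>iterate_law \<mu> n x t)"
proof -
  have k': "test_function W (noise_average (x (Suc t)) k)"
    using t x by (intro test_function_noise_average k) auto
  have W: "w \<in> W" if "w \<in> space \<mu>" for w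
    using that sets_eq_imp_space_eq[OF sets_\<mu>] by (simp add: space_restrict_space)
  have "t \<le> n" using t by simp
  show ?thesis
    unfolding integral_iterate_law[OF x t k] integral_iterate_law[OF x \<open>t \<le> n\<close> k']
    by (intro Bochner_Integration.integral_cong refl noise_average_pnsgd_iterate[OF x t k] W)
qed

lemma iterate_law_eq:
  assumes "\<And>s. s \<in> {1..t} \<Longrightarrow> x s = x' s"
  shows "iterate_law \<mu> n x t = iterate_law \<mu> n x' t"
proof -
  have "pnsgd_iterate W \<eta> \<sigma> grad x w z t = pnsgd_iterate W \<eta> \<sigma> grad x' w z t" for w z
    by (rule pnsgd_iterate_cong) (use assms in auto)
  then show ?thesis by (simp add: iterate_law_def)
qed

text \<open>Induction on the number \<open>j\<close> of steps after the differing entry, which is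
  written \<open>Suc i\<close> so that \<open>i\<close> indexes the law just before it.
  \<open>k\<close> stays arbitrary because the contraction needs the hypothesis for all test
  functions.\<close>

lemma iterate_law_bound:
  assumes x: "x \<in> {1..n} \<rightarrow> X" and x': "x' \<in> {1..n} \<rightarrow> X"
    and eq: "\<And>s. s \<in> {1..n} \<Longrightarrow> s \<noteq> Suc i \<Longrightarrow> x s = x' s"
    and W: "bounded W" and \<gamma>: "1 \<le> \<gamma>" and L: "0 \<le> L"
    and i: "Suc i + j \<le> n" and k: "test_function W k"
  shows "(\<integral>w. k w \<partial>iterate_law \<mu> n x (Suc i + j)) - \<gamma> * (\<integral>w. k w \<partial>iterate_law \<mu> n x' (Suc i + j))
    \<le> theta \<gamma> (2 * L / \<sigma>) * theta \<gamma> ((diameter W + 2 * \<eta> * L) / (\<eta> * \<sigma>)) ^ j"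
  using i k
proof (induct j arbitrary: k)
  case 0
  let ?P = "iterate_law \<mu> n x i"
  \<comment> \<open>Before the differing entry both runs have seen the same data, so the gap after
    it is an average, over the single law \<open>?P\<close>, of gaps from a common point.\<close>
  have same: "iterate_law \<mu> n x' i = ?P"
    using 0 eq by (intro iterate_law_eq) auto
  interpret P: prob_space ?P
    using 0 by (intro prob_space_iterate_law x) auto
  have id: "(\<lambda>w. w) \<in> measurable ?P (restrict_space borel W)"
    by (rule measurable_ident_sets[OF sets_iterate_law])
  have X: "x (Suc i) \<in> X" "x' (Suc i) \<in> X"
    using 0 x x' by auto
  have int: "integrable ?P (noise_average y k)" if "y \<in> X" for y
    using test_function_integrable[OF P.prob_space_axioms id test_function_noise_average[OF 0(2) that]] .
  have "(\<integral>w. k w \<partial>iterate_law \<mu> n x (Suc i)) - \<gamma> * (\<integral>w. k w \<partial>iterate_law \<mu> n x' (Suc i))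
    = (\<integral>w. noise_average (x (Suc i)) k w - \<gamma> * noise_average (x' (Suc i)) k w \<partial>?P)"
    using 0 int X by (simp add: integral_iterate_law_Suc[OF x] integral_iterate_law_Suc[OF x'] same)
  also have "\<dots> \<le> theta \<gamma> (2 * L / \<sigma>)"
    using int X 0(2) sets_eq_imp_space_eq[OF sets_iterate_law, of x i]
    by (intro P.integral_le_const AE_I2 noise_average_data_bound \<gamma>) (auto simp: space_restrict_space)
  finally show ?case by simp
next
  case (Suc j)
  let ?c = "theta \<gamma> ((diameter W + 2 * \<eta> * L) / (\<eta> * \<sigma>))"
  let ?t = "Suc i + j"
  have d: "0 \<le> (diameter W + 2 * \<eta> * L) / (\<eta> * \<sigma>)"
    using diameter_ge_0[OF W] \<eta>_pos \<sigma>_pos L by simp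
  have t: "Suc ?t \<le> n" using Suc.prems by simp
  have xt: "x' (Suc ?t) = x (Suc ?t)" "x (Suc ?t) \<in> X"
    using eq[of "Suc ?t", symmetric] t x by (force, auto)
  \<comment> \<open>The contraction asks that the bound so far be at most 1; all its factors lie in
    [0,1].\<close>
  have "theta \<gamma> (2 * L / \<sigma>) * ?c ^ j \<le> 1 * 1"
    using \<gamma> \<sigma>_pos L d
    by (intro mult_mono power_le_one theta_nonneg theta_less_1[THEN less_imp_le] zero_le_power) auto
  then have "(\<integral>w. noise_average (x (Suc ?t)) k w \<partial>iterate_law \<mu> n x ?t)
      - \<gamma> * (\<integral>w. noise_average (x (Suc ?t)) k w \<partial>iterate_law \<mu> n x' ?t)
     \<le> (theta \<gamma> (2 * L / \<sigma>) * ?c ^ j) * ?c"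
    using t Suc.prems(2) xt
    by (intro test_function_contraction[where W=W] prob_space_iterate_law x x' sets_iterate_law nonempty \<gamma>
        Suc.hyps test_function_noise_average noise_average_oscillation W) auto
  also have "(\<integral>w. noise_average (x (Suc ?t)) k w \<partial>iterate_law \<mu> n x ?t) = (\<integral>w. k w \<partial>iterate_law \<mu> n x (Suc ?t))"
    by (rule integral_iterate_law_Suc[OF x t Suc.prems(2), symmetric])
  also have "(\<integral>w. noise_average (x (Suc ?t)) k w \<partial>iterate_law \<mu> n x' ?t) = (\<integral>w. k w \<partial>iterate_law \<mu> n x' (Suc ?t))"
    unfolding xt(1)[symmetric] by (rule integral_iterate_law_Suc[OF x' t Suc.prems(2), symmetric])
  finally show ?case by (simp add: ac_simps)
qed

section \<open>Averaging over the random stopping time\<close>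

lemma integral_randomly_stopped_pnsgd:
  assumes n: "1 \<le> n" and x: "x \<in> {1..n} \<rightarrow> X" and k: "test_function W k"
  shows "(\<integral>w. k w \<partial>randomly_stopped_pnsgd W \<mu> \<eta> \<sigma> grad n x)
    = (\<Sum>t\<in>{1..n}. (\<integral>w. k w \<partial>iterate_law \<mu> n x t)) / n"
proof -
  let ?U = "uniform_count_measure {1..n}"
  let ?f = "\<lambda>(w, T, z). pnsgd_iterate W \<eta> \<sigma> grad x w z T"
  interpret U: prob_space ?U
    using n by (intro prob_space_uniform_count_measure) auto
  interpret UN: pair_prob_space ?U "noise n :: (nat \<Rightarrow> 'a) measure" ..
  interpret \<mu>UN: pair_prob_space \<mu> "?U \<Otimes>\<^sub>M (noise n :: (nat \<Rightarrow> 'a) measure)" ..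
  have [measurable_cong]: "sets ?U = sets (count_space {1..n})"
    by (simp add: sets_uniform_count_measure)
  \<comment> \<open>The stopping time takes finitely many values, so joint measurability reduces to
    that of the iterate at each fixed \<open>t\<close>.\<close>
  have "(\<lambda>p. (case (fst p, snd (snd p)) of (w, z) \<Rightarrow> pnsgd_iterate W \<eta> \<sigma> grad x w z (fst (snd p))))
      \<in> measurable (\<mu> \<Otimes>\<^sub>M (?U \<Otimes>\<^sub>M noise n)) (restrict_space borel W)"
  proof (rule measurable_compose_countable'[where I="{1..n}"])
    fix t assume "t \<in> {1..n}"
    then have [measurable]: "(\<lambda>(w, z). pnsgd_iterate W \<eta> \<sigma> grad x w z t) \<in> measurable (\<mu> \<Otimes>\<^sub>M noise n) (restrict_space borel W)"
      by (intro pnsgd_iterate_measurable_start x) auto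
    show "(\<lambda>p. (case (fst p, snd (snd p)) of (w, z) \<Rightarrow> pnsgd_iterate W \<eta> \<sigma> grad x w z t))
      \<in> measurable (\<mu> \<Otimes>\<^sub>M (?U \<Otimes>\<^sub>M noise n)) (restrict_space borel W)"
      by measurable
  qed (auto intro: countable_finite)
  then have meas: "?f \<in> measurable (\<mu> \<Otimes>\<^sub>M (?U \<Otimes>\<^sub>M noise n)) (restrict_space borel W)"
    by (simp add: case_prod_unfold)
  have int: "integrable (\<mu> \<Otimes>\<^sub>M (?U \<Otimes>\<^sub>M noise n)) (\<lambda>p. k (?f p))"
    by (rule test_function_integrable[OF _ meas k]) (rule \<mu>UN.P.prob_space_axioms)
  have inner: "(\<integral>q. k (?f (w, q)) \<partial>(?U \<Otimes>\<^sub>M noise n))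
     = (\<Sum>t\<in>{1..n}. (\<integral>z. k (pnsgd_iterate W \<eta> \<sigma> grad x w z t) \<partial>noise n)) / n"
    if w: "w \<in> space \<mu>" for w
  proof -
    have "integrable (?U \<Otimes>\<^sub>M noise n) (\<lambda>q. k (?f (w, q)))"
      by (rule test_function_integrable[OF _ measurable_Pair2[OF meas w] k]) (rule UN.P.prob_space_axioms)
    from UN.integral_fst'[OF this] show ?thesis
      by (simp add: integral_uniform_count_measure)
  qed
  have "(\<integral>w. k w \<partial>randomly_stopped_pnsgd W \<mu> \<eta> \<sigma> grad n x) = (\<integral>p. k (?f p) \<partial>(\<mu> \<Otimes>\<^sub>M (?U \<Otimes>\<^sub>M noise n)))"
    unfolding randomly_stopped_pnsgd_def using k
    by (subst integral_distr[OF meas]) (auto simp: test_function_def)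
  also have "\<dots> = (\<integral>w. (\<integral>q. k (?f (w, q)) \<partial>(?U \<Otimes>\<^sub>M noise n)) \<partial>\<mu>)"
    by (rule \<mu>UN.integral_fst'[OF int, symmetric])
  also have "\<dots> = (\<integral>w. (\<Sum>t\<in>{1..n}. (\<integral>z. k (pnsgd_iterate W \<eta> \<sigma> grad x w z t) \<partial>noise n)) / n \<partial>\<mu>)"
    by (intro Bochner_Integration.integral_cong refl inner)
  also have "\<dots> = (\<Sum>t\<in>{1..n}. (\<integral>w. (\<integral>z. k (pnsgd_iterate W \<eta> \<sigma> grad x w z t) \<partial>noise n) \<partial>\<mu>)) / n"
  proof -
    have "integrable \<mu> (\<lambda>w. \<integral>z. k (pnsgd_iterate W \<eta> \<sigma> grad x w z t) \<partial>noise n)" if "t \<in> {1..n}" for t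
    proof -
      have "integrable (\<mu> \<Otimes>\<^sub>M noise n) (\<lambda>p. k (case p of (w, z) \<Rightarrow> pnsgd_iterate W \<eta> \<sigma> grad x w z t))"
        using that by (intro test_function_integrable[OF _ pnsgd_iterate_measurable_start[OF x] k]
            start.P.prob_space_axioms) auto
      from start.integrable_fst'[OF this] show ?thesis by simp
    qed
    then show ?thesis
      by (simp add: Bochner_Integration.integral_sum)
  qed
  also have "\<dots> = (\<Sum>t\<in>{1..n}. (\<integral>w. k w \<partial>iterate_law \<mu> n x t)) / n"
    by (simp add: integral_iterate_law[OF x _ k])
  finally show ?thesis .
qed

lemma E_divergence_randomly_stopped_pnsgd:
  assumes x: "x \<in> {1..n} \<rightarrow> X" and x': "x' \<in> {1..n} \<rightarrow> X"
    and i: "Suc i \<le> n" and eq: "\<And>s. s \<in> {1..n} \<Longrightarrow> s \<noteq> Suc i \<Longrightarrow> x s = x' s"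
    and W: "bounded W" and \<gamma>: "1 \<le> \<gamma>" and L: "0 \<le> L"
  shows "E_divergence \<gamma> (randomly_stopped_pnsgd W \<mu> \<eta> \<sigma> grad n x) (randomly_stopped_pnsgd W \<mu> \<eta> \<sigma> grad n x')
    \<le> 1 / real n * theta \<gamma> (2 * L / \<sigma>) * inverse (1 - theta \<gamma> ((diameter W + 2 * \<eta> * L) / (\<eta> * \<sigma>)))"
  unfolding E_divergence_def
proof (rule cSUP_least)
  let ?mech = "randomly_stopped_pnsgd W \<mu> \<eta> \<sigma> grad n"
  let ?a = "theta \<gamma> (2 * L / \<sigma>)" and ?c = "theta \<gamma> ((diameter W + 2 * \<eta> * L) / (\<eta> * \<sigma>))"
  show "sets (?mech x) \<noteq> {}" by (metis empty_iff sets.top)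
  fix A assume "A \<in> sets (?mech x)"
  then have A: "A \<in> sets (restrict_space borel W)"
    by (simp add: randomly_stopped_pnsgd_def)
  define k :: "'a \<Rightarrow> real" where "k = indicator A"
  have k: "test_function W k"
    using A by (auto simp: test_function_def k_def)
  have meas: "measure (?mech y) A = (\<integral>w. k w \<partial>?mech y)" for y
    using sets.sets_into_space[OF A] unfolding k_def
    by (simp add: randomly_stopped_pnsgd_def Int_absorb2)
  define D where "D t = (\<integral>w. k w \<partial>iterate_law \<mu> n x t) - \<gamma> * (\<integral>w. k w \<partial>iterate_law \<mu> n x' t)" for t
  have a: "0 \<le> ?a" using \<gamma> L \<sigma>_pos by (intro theta_nonneg) auto
  have c: "0 \<le> ?c" "?c < 1"
    using \<gamma> L \<sigma>_pos \<eta>_pos diameter_ge_0[OF W] by (auto intro!: theta_nonneg theta_less_1)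
  \<comment> \<open>Stopping before the differing entry gives equal laws, and
    \<open>\<gamma> \<ge> 1\<close> then makes the gap nonpositive.\<close>
  have early: "D t \<le> 0" if "t \<in> {1..n} - {Suc i..n}" for t
  proof -
    have "iterate_law \<mu> n x' t = iterate_law \<mu> n x t"
      using that eq by (intro iterate_law_eq) auto
    moreover have "0 \<le> (\<integral>w. k w \<partial>iterate_law \<mu> n x t)"
      by (simp add: k_def)
    ultimately show ?thesis
      using \<gamma> mult_right_mono[of 1 \<gamma> "\<integral>w. k w \<partial>iterate_law \<mu> n x t"] by (simp add: D_def)
  qed
  have late: "D (Suc i + j) \<le> ?a * ?c ^ j" if "Suc i + j \<le> n" for j
    unfolding D_def by (rule iterate_law_bound[OF x x' eq W \<gamma> L that k])
  have "(\<Sum>t\<in>{1..n}. D t) = (\<Sum>t\<in>{1..n} - {Suc i..n}. D t) + (\<Sum>t\<in>{Suc i..n}. D t)"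
    using i by (intro sum.subset_diff) auto
  also have "\<dots> \<le> (\<Sum>t\<in>{Suc i..n}. D t)"
    using sum_nonpos[of "{1..n} - {Suc i..n}" D, OF early] by linarith
  \<comment> \<open>\<open>j\<close> counts the steps after the differing entry, so that
    \<open>j = 0\<close> is stopping right at it.\<close>
  also have "\<dots> = (\<Sum>j<n - i. D (Suc i + j))"
    by (rule sum.reindex_bij_witness[where i="\<lambda>j. Suc i + j" and j="\<lambda>t. t - Suc i"]) auto
  also have "\<dots> \<le> (\<Sum>j<n - i. ?a * ?c ^ j)"
    by (intro sum_mono late) auto
  also have "\<dots> = ?a * (\<Sum>j<n - i. ?c ^ j)"
    by (simp add: sum_distrib_left)
  \<comment> \<open>The partial geometric sum is bounded by the full series, which removes the
    dependence on the position of the differing entry.\<close>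
  also have "\<dots> \<le> ?a * inverse (1 - ?c)"
    using c a by (intro mult_left_mono) (auto simp: sum_gp_strict divide_inverse)
  finally have sum: "(\<Sum>t\<in>{1..n}. D t) \<le> ?a * inverse (1 - ?c)" .
  have "measure (?mech x) A - \<gamma> * measure (?mech x') A = (\<Sum>t\<in>{1..n}. D t) / n"
    using i unfolding meas D_def
    by (simp add: integral_randomly_stopped_pnsgd[OF _ x k] integral_randomly_stopped_pnsgd[OF _ x' k]
        sum_subtractf sum_distrib_left diff_divide_distrib)
  also have "\<dots> \<le> (?a * inverse (1 - ?c)) / n"
    by (intro divide_right_mono sum) simp
  finally show "measure (?mech x) A - \<gamma> * measure (?mech x') A \<le> 1 / real n * ?a * inverse (1 - ?c)"
    by simp
qed

end
end

theorem corollary5: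
  fixes W :: "'a::euclidean_space set"
    and X :: "'x set"
    and l :: "'a \<Rightarrow> 'x \<Rightarrow> real"
    and grad :: "'a \<Rightarrow> 'x \<Rightarrow> 'a"
    and \<mu>\<^sub>1 :: "'a measure"
    and L \<eta> \<sigma> \<epsilon> :: real
    and n :: nat
  assumes "closed W" and "convex W"
    and "\<And>x. x \<in> X \<Longrightarrow> convex_on W (\<lambda>w. l w x)"
    and "\<And>w x. w \<in> W \<Longrightarrow> x \<in> X \<Longrightarrow>
           ((\<lambda>v. l v x) has_derivative (\<lambda>h. grad w x \<bullet> h)) (at w within W)"
    and "\<And>x. x \<in> X \<Longrightarrow> L-lipschitz_on W (\<lambda>w. l w x)"
    and "prob_space \<mu>\<^sub>1" and "sets \<mu>\<^sub>1 = sets (restrict_space borel W)"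
    and "\<eta> > 0" and "\<sigma> > 0" and "n \<ge> 1" and "\<epsilon> \<ge> 0"
  shows "differentially_private X n (randomly_stopped_pnsgd W \<mu>\<^sub>1 \<eta> \<sigma> grad n) \<epsilon>
           (if bounded W
            then ereal (1 / real n * theta (exp \<epsilon>) (2 * L / \<sigma>) *
                   inverse (1 - theta (exp \<epsilon>) ((diameter W + 2 * \<eta> * L) / (\<eta> * \<sigma>))))
            else \<infinity>)"
proof (cases "bounded W")
  case True
  have W: "W \<noteq> {}"
    using prob_space.not_empty[OF assms(6)] sets_eq_imp_space_eq[OF assms(7)]
    by (simp add: space_restrict_space)
  interpret noisy_sgd W X grad L \<eta> \<sigma>
  proof
    fix x assume x: "x \<in> X"
    obtain gT where "gT \<in> borel_measurable (restrict_space borel W)" "\<And>w. w \<in> W \<Longrightarrow> norm (gT w) \<le> L"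
      "\<And>w a b. w \<in> W \<Longrightarrow> a \<in> W \<Longrightarrow> b \<in> W \<Longrightarrow> (grad w x - gT w) \<bullet> (a - b) = 0"
      using tangential_gradient[OF assms(2) W assms(4)[OF _ x] assms(5)[OF x]] by metis
    then show "\<exists>gT\<in>borel_measurable (restrict_space borel W).
      (\<forall>w\<in>W. norm (gT w) \<le> L) \<and> (\<forall>w\<in>W. \<forall>a\<in>W. \<forall>b\<in>W. (grad w x - gT w) \<bullet> (a - b) = 0)"
      by blast
  qed (use assms(1,2,8,9) W in auto)
  have "E_divergence (exp \<epsilon>) (randomly_stopped_pnsgd W \<mu>\<^sub>1 \<eta> \<sigma> grad n x) (randomly_stopped_pnsgd W \<mu>\<^sub>1 \<eta> \<sigma> grad n x')
      \<le> 1 / real n * theta (exp \<epsilon>) (2 * L / \<sigma>) *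
         inverse (1 - theta (exp \<epsilon>) ((diameter W + 2 * \<eta> * L) / (\<eta> * \<sigma>)))"
    if x: "x \<in> {1..n} \<rightarrow>\<^sub>E X" "x' \<in> {1..n} \<rightarrow>\<^sub>E X" and ex: "\<exists>!i. i \<in> {1..n} \<and> x i \<noteq> x' i" for x x'
  proof -
    obtain i where i: "i \<in> {1..n}" "\<And>s. s \<in> {1..n} \<Longrightarrow> s \<noteq> i \<Longrightarrow> x s = x' s"
      using ex by metis
    \<comment> \<open>The bound expects the differing entry as a successor; entries start at 1, so
      \<open>i - 1\<close> is a true predecessor.\<close>
    have Suc_i: "Suc (i - 1) = i" using i(1) by simp
    \<comment> \<open>The Lipschitz condition at any data point forces \<open>L \<ge> 0\<close>; the
      differing entry supplies a point of \<open>X\<close>.\<close>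
    have "x i \<in> X" using x i(1) by auto
    then have "0 \<le> L" using lipschitz_on_nonneg[OF assms(5)] by blast
    then show ?thesis
      using i x assms True Suc_i
      by (intro E_divergence_randomly_stopped_pnsgd[where i="i - 1"]) auto
  qed
  then show ?thesis
    using True by (simp add: differentially_private_def)
qed (simp add: differentially_private_def)

end
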